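(* Let $\mathsf P$ be a grounded Petri net and $\mathsf B\to\mathsf P$ an initial marking given by a finite set $B$. Then: (1) There is a universal unfolding $\mathsf B\to\mathsf U_B\mathsf P\xrightarrow{\varepsilon}\mathsf P$ of $\mathsf P$ from $B$: for every unfolding $\mathsf B\to\mathsf H\to\mathsf P$ of $\mathsf P$ from $B$ there is a unique morphism of $B$-hypergraphs $\mathsf H\to\mathsf U_B\mathsf P$ (an etale map compatible with the maps from $\mathsf B$) whose composite with $\varepsilon$ is the given map $\mathsf H\to\mathsf P$. (2) The universal unfolding is the colimit, in the category of $B$-hypergraphs, of all $\mathsf P$-processes starting at $B$: $\mathsf U_B\mathsf P=\operatorname{colim}_{\mathsf B\to\mathsf G\to\mathsf P}\mathsf G$.
   Context: A Petri net is a diagram of sets $S\leftarrow I\to T\leftarrow O\to S$ (here temporarily allowed infinite, but with the maps $I\to T$ and $O\to T$ having finite fibres); the given $\mathsf P$ is finite. It is grounded if $I\to T$ is surjective. A morphism of such diagrams consists of maps on the four sets (the same map on both copies of the outer set) making all squares commute; it is etale if the two middle squares (over $T'\to T$) are pullbacks. For a finite set $B$, $\mathsf B$ denotes $B\emptyset\emptyset\emptyset B$; a marking is an etale map $\mathsf B\to\mathsf P$, i.e. a map $B\to S$. A hypergraph is a diagram of sets $A\leftarrow I\to N\leftarrow O\to A$ in which the two spans $A\leftarrow I\to N$ and $N\leftarrow O\to A$ are relations (jointly injective) and $I\to N$, $O\to N$ have finite fibres; it is forward if $O\to A$ is injective. Write $x\lessdot y$ for nodes if some hyperedge $a$ is $O$-related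 to $x$ and $I$-related to $y$; let $<$ be the transitive closure and $\le$ the reflexive-transitive closure. A hypergraph is well-founded if $<$ is irreflexive and $\{x\mid x\le y\}$ is finite for every node $y$. A $B$-hypergraph is a forward hypergraph with a map $\mathsf B\to\mathsf H$ identifying $B$ bijectively with its in-boundary (the complement of the image of $O\to A$); $B$-maps are etale maps compatible with the maps from $\mathsf B$. The principal lowerset $\mathsf H\downarrow y$ of a node $y$ is the open sub-hypergraph with node set $\{x\mid x\le y\}$ and all hyperedges incident to these nodes. An occurrence hypergraph is a well-founded forward hypergraph all of whose principal lowersets are graphs (outer maps injective). An unfolding of $\mathsf P$ from $B$ is a commutative triangle of etale maps $\mathsf B\to\mathsf H\to\mathsf P$, $\mathsf B\to\mathsf P$ with $\mathsf B\to\mathsf H$ an occurrence $B$-hypergraph. A $\mathsf P$-process from $B$ is a commutative triangle of etale maps $\mathsf B\to\mathsf G\to\mathsf P$ with $\mathsf G$ a finite acyclic graph (finite diagram $A\leftarrow I\to N\leftarrow O\to A$ with both outer maps injective and no directed cycles) and $\mathsf B\to\mathsf G$ a bijection onto the in-boundary of $\mathsf G$; the diagram in (2) consists of these and their morphisms (maps of $\mathsf P$-graphs under $\mathsf B$). *)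

theory Defs
  imports Main "HOL-Library.FuncSet"
begin

section \<open>Diagrams and their maps\<close>

text \<open>
  A diagram of sets S <- I -> T <- O -> S. The same type serves for Petri nets (edges are the
  places, nodes are the transitions), hypergraphs and graphs. Only the values of the four
  structure maps on the respective carriers matter.
\<close>

record ('s, 'i, 't, 'o) net =
  edges :: "'s set"
  ins :: "'i set"
  nodes :: "'t set"
  outs :: "'o set"
  in_edge :: "'i \<Rightarrow> 's"
  in_node :: "'i \<Rightarrow> 't"
  out_node :: "'o \<Rightarrow> 't"
  out_edge :: "'o \<Rightarrow> 's"

definition net :: "('s, 'i, 't, 'o) net \<Rightarrow> bool" where
  "net N \<longleftrightarrow>
     in_edge N \<in> ins N \<rightarrow> edges N \<and> in_node N \<in> ins N \<rightarrow> nodes N \<and>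
     out_node N \<in> outs N \<rightarrow> nodes N \<and> out_edge N \<in> outs N \<rightarrow> edges N \<and>
     (\<forall>t\<in>nodes N. finite {i \<in> ins N. in_node N i = t} \<and> finite {q \<in> outs N. out_node N q = t})"

definition finite_net :: "('s, 'i, 't, 'o) net \<Rightarrow> bool" where
  "finite_net N \<longleftrightarrow>
     net N \<and> finite (edges N) \<and> finite (ins N) \<and> finite (nodes N) \<and> finite (outs N)"

definition grounded :: "('s, 'i, 't, 'o) net \<Rightarrow> bool" where
  "grounded P \<longleftrightarrow> in_node P ` ins P = nodes P"

record ('s, 'i, 't, 'o, 's2, 'i2, 't2, 'o2) net_map =
  on_edges :: "'s \<Rightarrow> 's2"
  on_ins :: "'i \<Rightarrow> 'i2"
  on_nodes :: "'t \<Rightarrow> 't2"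
  on_outs :: "'o \<Rightarrow> 'o2"

text \<open>
  The component functions are extensional (undefined off the carriers), so that HOL equality of
  maps is equality of morphisms and unique existence has its intended meaning.
\<close>

definition net_map ::
  "('s, 'i, 't, 'o) net \<Rightarrow> ('s2, 'i2, 't2, 'o2) net \<Rightarrow>
   ('s, 'i, 't, 'o, 's2, 'i2, 't2, 'o2) net_map \<Rightarrow> bool" where
  "net_map M N f \<longleftrightarrow>
     on_edges f \<in> edges M \<rightarrow>\<^sub>E edges N \<and> on_ins f \<in> ins M \<rightarrow>\<^sub>E ins N \<and>
     on_nodes f \<in> nodes M \<rightarrow>\<^sub>E nodes N \<and> on_outs f \<in> outs M \<rightarrow>\<^sub>E outs N \<and>
     (\<forall>i\<in>ins M. in_edge N (on_ins f i) = on_edges f (in_edge M i)) \<and>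
     (\<forall>i\<in>ins M. in_node N (on_ins f i) = on_nodes f (in_node M i)) \<and>
     (\<forall>q\<in>outs M. out_node N (on_outs f q) = on_nodes f (out_node M q)) \<and>
     (\<forall>q\<in>outs M. out_edge N (on_outs f q) = on_edges f (out_edge M q))"

text \<open>
  The square with top h : X' -> X, left p : X' -> T', right q : X -> T and bottom g : T' -> T
  is a pullback of sets.
\<close>

definition pullback_square ::
  "'x2 set \<Rightarrow> 'x set \<Rightarrow> 't2 set \<Rightarrow> ('x2 \<Rightarrow> 'x) \<Rightarrow> ('x2 \<Rightarrow> 't2) \<Rightarrow> ('x \<Rightarrow> 't) \<Rightarrow> ('t2 \<Rightarrow> 't) \<Rightarrow> bool"
  where
  "pullback_square X' X T' h p q g \<longleftrightarrow>
     bij_betw (\<lambda>x. (h x, p x)) X' {(y, t). y \<in> X \<and> t \<in> T' \<and> q y = g t}"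

definition etale ::
  "('s, 'i, 't, 'o) net \<Rightarrow> ('s2, 'i2, 't2, 'o2) net \<Rightarrow>
   ('s, 'i, 't, 'o, 's2, 'i2, 't2, 'o2) net_map \<Rightarrow> bool" where
  "etale M N f \<longleftrightarrow> net_map M N f \<and>
     pullback_square (ins M) (ins N) (nodes M) (on_ins f) (in_node M) (in_node N) (on_nodes f) \<and>
     pullback_square (outs M) (outs N) (nodes M) (on_outs f) (out_node M) (out_node N) (on_nodes f)"

text \<open>\<^term>\<open>net_comp M g f\<close> is the composite of f with source M, followed by g.\<close>

definition net_comp ::
  "('s, 'i, 't, 'o) net \<Rightarrow>
   ('s2, 'i2, 't2, 'o2, 's3, 'i3, 't3, 'o3) net_map \<Rightarrow>
   ('s, 'i, 't, 'o, 's2, 'i2, 't2, 'o2) net_map \<Rightarrow>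
   ('s, 'i, 't, 'o, 's3, 'i3, 't3, 'o3) net_map" where
  "net_comp M g f =
     \<lparr> on_edges = compose (edges M) (on_edges g) (on_edges f),
       on_ins = compose (ins M) (on_ins g) (on_ins f),
       on_nodes = compose (nodes M) (on_nodes g) (on_nodes f),
       on_outs = compose (outs M) (on_outs g) (on_outs f) \<rparr>"

definition discrete :: "'b set \<Rightarrow> ('b, unit, unit, unit) net" where
  "discrete B =
     \<lparr> edges = B, ins = {}, nodes = {}, outs = {},
       in_edge = (\<lambda>_. undefined), in_node = (\<lambda>_. undefined),
       out_node = (\<lambda>_. undefined), out_edge = (\<lambda>_. undefined) \<rparr>"

text \<open>
  The components of an etale map out of \<^term>\<open>discrete B\<close> other than \<^term>\<open>on_edges\<close> are
  maps out of the empty set, so a marking amounts to a map from B to the places of P.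
\<close>

definition marking ::
  "('s, 'i, 't, 'o) net \<Rightarrow> 'b set \<Rightarrow> ('b, unit, unit, unit, 's, 'i, 't, 'o) net_map \<Rightarrow> bool" where
  "marking P B m \<longleftrightarrow> finite B \<and> etale (discrete B) P m"


section \<open>Hypergraphs\<close>

definition hypergraph :: "('a, 'i, 'n, 'o) net \<Rightarrow> bool" where
  "hypergraph H \<longleftrightarrow> net H \<and>
     inj_on (\<lambda>i. (in_edge H i, in_node H i)) (ins H) \<and>
     inj_on (\<lambda>q. (out_node H q, out_edge H q)) (outs H)"

definition forward :: "('a, 'i, 'n, 'o) net \<Rightarrow> bool" where
  "forward H \<longleftrightarrow> inj_on (out_edge H) (outs H)"

definition graph :: "('a, 'i, 'n, 'o) net \<Rightarrow> bool" where
  "graph G \<longleftrightarrow> net G \<and> inj_on (in_edge G) (ins G) \<and> inj_on (out_edge G) (outs G)"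

definition prec :: "('a, 'i, 'n, 'o) net \<Rightarrow> 'n rel" where
  "prec H = {(x, y). \<exists>a\<in>edges H.
     (\<exists>q\<in>outs H. out_node H q = x \<and> out_edge H q = a) \<and>
     (\<exists>i\<in>ins H. in_edge H i = a \<and> in_node H i = y)}"

definition well_founded :: "('a, 'i, 'n, 'o) net \<Rightarrow> bool" where
  "well_founded H \<longleftrightarrow> irrefl ((prec H)\<^sup>+) \<and> (\<forall>y\<in>nodes H. finite {x. (x, y) \<in> (prec H)\<^sup>*})"

definition open_sub :: "('a, 'i, 'n, 'o) net \<Rightarrow> 'n set \<Rightarrow> ('a, 'i, 'n, 'o) net" where
  "open_sub H X =
     H\<lparr> edges := in_edge H ` {i \<in> ins H. in_node H i \<in> X} \<union> out_edge H ` {q \<in> outs H. out_node H q \<in> X},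
        ins := {i \<in> ins H. in_node H i \<in> X},
        nodes := X,
        outs := {q \<in> outs H. out_node H q \<in> X} \<rparr>"

definition principal_lowerset :: "('a, 'i, 'n, 'o) net \<Rightarrow> 'n \<Rightarrow> ('a, 'i, 'n, 'o) net" where
  "principal_lowerset H y = open_sub H {x. (x, y) \<in> (prec H)\<^sup>*}"

definition occurrence_hypergraph :: "('a, 'i, 'n, 'o) net \<Rightarrow> bool" where
  "occurrence_hypergraph H \<longleftrightarrow>
     hypergraph H \<and> forward H \<and> well_founded H \<and> (\<forall>y\<in>nodes H. graph (principal_lowerset H y))"

definition in_boundary :: "('a, 'i, 'n, 'o) net \<Rightarrow> 'a set" where
  "in_boundary H = edges H - out_edge H ` outs H"

definition B_hypergraph ::
  "'b set \<Rightarrow> ('a, 'i, 'n, 'o) net \<Rightarrow> ('b, unit, unit, unit, 'a, 'i, 'n, 'o) net_map \<Rightarrow> bool" where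
  "B_hypergraph B H j \<longleftrightarrow>
     hypergraph H \<and> forward H \<and> etale (discrete B) H j \<and> bij_betw (on_edges j) B (in_boundary H)"

text \<open>Etale maps from (H, j) to (K, l) under B, where j and l are the maps from \<^term>\<open>discrete B\<close>.\<close>

definition B_map ::
  "'b set \<Rightarrow>
   ('a, 'i, 'n, 'o) net \<Rightarrow> ('b, unit, unit, unit, 'a, 'i, 'n, 'o) net_map \<Rightarrow>
   ('a2, 'i2, 'n2, 'o2) net \<Rightarrow> ('b, unit, unit, unit, 'a2, 'i2, 'n2, 'o2) net_map \<Rightarrow>
   ('a, 'i, 'n, 'o, 'a2, 'i2, 'n2, 'o2) net_map \<Rightarrow> bool" where
  "B_map B H j K l f \<longleftrightarrow> etale H K f \<and> net_comp (discrete B) f j = l"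


section \<open>Unfoldings and processes\<close>

definition is_unfolding ::
  "('s, 'i, 't, 'o) net \<Rightarrow> 'b set \<Rightarrow> ('b, unit, unit, unit, 's, 'i, 't, 'o) net_map \<Rightarrow>
   ('a2, 'i2, 'n2, 'o2) net \<Rightarrow> ('b, unit, unit, unit, 'a2, 'i2, 'n2, 'o2) net_map \<Rightarrow>
   ('a2, 'i2, 'n2, 'o2, 's, 'i, 't, 'o) net_map \<Rightarrow> bool" where
  "is_unfolding P B m H j p \<longleftrightarrow>
     occurrence_hypergraph H \<and> B_hypergraph B H j \<and> etale H P p \<and> net_comp (discrete B) p j = m"

text \<open>
  The test objects H of the universal property range over all hypergraphs on the carrier types
  given by the first argument (HOL cannot quantify over types inside a formula).
\<close>

definition universal_unfolding ::
  "('a, 'e, 'n, 'r) net itself \<Rightarrow>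
   ('s, 'i, 't, 'o) net \<Rightarrow> 'b set \<Rightarrow> ('b, unit, unit, unit, 's, 'i, 't, 'o) net_map \<Rightarrow>
   ('a2, 'i2, 'n2, 'o2) net \<Rightarrow> ('b, unit, unit, unit, 'a2, 'i2, 'n2, 'o2) net_map \<Rightarrow>
   ('a2, 'i2, 'n2, 'o2, 's, 'i, 't, 'o) net_map \<Rightarrow> bool" where
  "universal_unfolding _ P B m U j \<epsilon> \<longleftrightarrow>
     is_unfolding P B m U j \<epsilon> \<and>
     (\<forall>(H :: ('a, 'e, 'n, 'r) net) k p. is_unfolding P B m H k p \<longrightarrow>
        (\<exists>!f. B_map B H k U j f \<and> net_comp H \<epsilon> f = p))"

definition is_process ::
  "('s, 'i, 't, 'o) net \<Rightarrow> 'b set \<Rightarrow> ('b, unit, unit, unit, 's, 'i, 't, 'o) net_map \<Rightarrow>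
   ('a2, 'i2, 'n2, 'o2) net \<Rightarrow> ('b, unit, unit, unit, 'a2, 'i2, 'n2, 'o2) net_map \<Rightarrow>
   ('a2, 'i2, 'n2, 'o2, 's, 'i, 't, 'o) net_map \<Rightarrow> bool" where
  "is_process P B m G k p \<longleftrightarrow>
     finite_net G \<and> graph G \<and> acyclic (prec G) \<and>
     etale (discrete B) G k \<and> bij_betw (on_edges k) B (in_boundary G) \<and>
     etale G P p \<and> net_comp (discrete B) p k = m"

definition process_map ::
  "'b set \<Rightarrow>
   ('a, 'e, 'n, 'r) net \<Rightarrow> ('b, unit, unit, unit, 'a, 'e, 'n, 'r) net_map \<Rightarrow>
   ('a, 'e, 'n, 'r, 's, 'i, 't, 'o) net_map \<Rightarrow>
   ('a2, 'i2, 'n2, 'o2) net \<Rightarrow> ('b, unit, unit, unit, 'a2, 'i2, 'n2, 'o2) net_map \<Rightarrow>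
   ('a2, 'i2, 'n2, 'o2, 's, 'i, 't, 'o) net_map \<Rightarrow>
   ('a, 'e, 'n, 'r, 'a2, 'i2, 'n2, 'o2) net_map \<Rightarrow> bool" where
  "process_map B G k p G' k' p' h \<longleftrightarrow> B_map B G k G' k' h \<and> net_comp G p' h = p"


section \<open>The colimit of all processes\<close>

text \<open>
  Every finite net is isomorphic to one whose carriers are sets of natural numbers, so the
  processes on such carriers, with all maps between them, form a small category equivalent to
  that of all processes; this is the shape of the diagram. A family of legs assigns a map to each
  process G with its maps k from \<^term>\<open>discrete B\<close> and p to P.
\<close>

type_synonym nnet = "(nat, nat, nat, nat) net"

type_synonym ('b, 's, 'i, 't, 'o, 'a2, 'i2, 'n2, 'o2) legs =
  "nnet \<Rightarrow> ('b, unit, unit, unit, nat, nat, nat, nat) net_map \<Rightarrow>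
   (nat, nat, nat, nat, 's, 'i, 't, 'o) net_map \<Rightarrow>
   (nat, nat, nat, nat, 'a2, 'i2, 'n2, 'o2) net_map"

definition process_cocone ::
  "('s, 'i, 't, 'o) net \<Rightarrow> 'b set \<Rightarrow> ('b, unit, unit, unit, 's, 'i, 't, 'o) net_map \<Rightarrow>
   ('a2, 'i2, 'n2, 'o2) net \<Rightarrow> ('b, unit, unit, unit, 'a2, 'i2, 'n2, 'o2) net_map \<Rightarrow>
   ('b, 's, 'i, 't, 'o, 'a2, 'i2, 'n2, 'o2) legs \<Rightarrow> bool" where
  "process_cocone P B m K l c \<longleftrightarrow>
     B_hypergraph B K l \<and>
     (\<forall>G k p. is_process P B m G k p \<longrightarrow> B_map B G k K l (c G k p)) \<and>
     (\<forall>G k p G' k' p' h.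
        is_process P B m G k p \<and> is_process P B m G' k' p' \<and> process_map B G k p G' k' p' h \<longrightarrow>
        net_comp G (c G' k' p') h = c G k p)"

text \<open>
  Universality among cocones in the category of B-hypergraphs; as before, the first argument
  fixes the carrier types of the vertices K of the competing cocones.
\<close>

definition process_colimit ::
  "('a, 'e, 'n, 'r) net itself \<Rightarrow>
   ('s, 'i, 't, 'o) net \<Rightarrow> 'b set \<Rightarrow> ('b, unit, unit, unit, 's, 'i, 't, 'o) net_map \<Rightarrow>
   ('a2, 'i2, 'n2, 'o2) net \<Rightarrow> ('b, unit, unit, unit, 'a2, 'i2, 'n2, 'o2) net_map \<Rightarrow>
   ('b, 's, 'i, 't, 'o, 'a2, 'i2, 'n2, 'o2) legs \<Rightarrow> bool" where
  "process_colimit _ P B m U j c \<longleftrightarrow>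
     process_cocone P B m U j c \<and>
     (\<forall>(K :: ('a, 'e, 'n, 'r) net) l d. process_cocone P B m K l d \<longrightarrow>
        (\<exists>!u. B_map B U j K l u \<and>
          (\<forall>G k p. is_process P B m G k p \<longrightarrow> net_comp G u (c G k p) = d G k p)))"

end

theory Submission
  imports Defs "HOL-Library.Countable_Set"
begin

text \<open>
  In an unfolding the lower set of a node, together with the whole in-boundary, is a process. An
  etale map preserves lower sets, so any two processes over the unfolding that hit the same node
  agree there up to a common sub-process; hence every unfolding is the colimit of the processes
  over it. A universal unfolding receives exactly one map from each process, which turns this into
  the colimit formula and also lifts the universal property from countable test objects to
  arbitrary ones.

  For existence, an event is a transition with a conflict-free assignment of previously produced
  conditions to its in-arcs. An unfolding is mapped there by well-founded recursion; the map is
  injective on lower sets because every transition has an in-arc along which equality of images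
  can be pushed down. Only finitely many events occur at each depth, so the construction is
  countable and has a copy on the natural numbers.
\<close>

section \<open>Etale maps\<close>

text \<open>Forwardness makes every edge of a \<open>B\<close>-hypergraph either the image of a
  unique element of \<open>B\<close> or the target of a unique out-arc, and an etale map lifts arcs
  uniquely at each node. A map under \<open>B\<close> is thus controlled by nodes and arcs, which
  are visible on lower sets, and the edges follow. This is why a lower-set process has to carry all
  tokens.

  The statement fixes carrier types, and its hypothesis on \<open>U\<close> speaks of natural-number
  carriers only. Processes are finite, so they already live there; the detour through colimits is
  what changes the carrier type of the test objects.

  A condition is a term that records its whole history, so two firings of a transition on the same
  inputs are the same term. This identification is what makes maps into the net of events unique,
  and it is also the obstacle to their existence: two nodes of one lower set must not receive the
  same event. A transition without in-arcs would have only one possible event, however many nodes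
  lie over it.\<close>

lemma netD:
  assumes "net N"
  shows "i \<in> ins N \<Longrightarrow> in_edge N i \<in> edges N" "i \<in> ins N \<Longrightarrow> in_node N i \<in> nodes N"
    "q \<in> outs N \<Longrightarrow> out_node N q \<in> nodes N" "q \<in> outs N \<Longrightarrow> out_edge N q \<in> edges N"
    "t \<in> nodes N \<Longrightarrow> finite {i \<in> ins N. in_node N i = t}"
    "t \<in> nodes N \<Longrightarrow> finite {q \<in> outs N. out_node N q = t}"
  using assms by (auto simp: net_def)

lemma net_mapD:
  assumes "net_map M N f"
  shows "a \<in> edges M \<Longrightarrow> on_edges f a \<in> edges N" "i \<in> ins M \<Longrightarrow> on_ins f i \<in> ins N"
    "x \<in> nodes M \<Longrightarrow> on_nodes f x \<in> nodes N" "q \<in> outs M \<Longrightarrow> on_outs f q \<in> outs N"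
    "i \<in> ins M \<Longrightarrow> in_edge N (on_ins f i) = on_edges f (in_edge M i)"
    "i \<in> ins M \<Longrightarrow> in_node N (on_ins f i) = on_nodes f (in_node M i)"
    "q \<in> outs M \<Longrightarrow> out_node N (on_outs f q) = on_nodes f (out_node M q)"
    "q \<in> outs M \<Longrightarrow> out_edge N (on_outs f q) = on_edges f (out_edge M q)"
  using assms by (auto simp: net_map_def)

lemma net_map_eqI:
  assumes "net_map M N f" "net_map M N' g"
    and "\<And>a. a \<in> edges M \<Longrightarrow> on_edges f a = on_edges g a"
    and "\<And>i. i \<in> ins M \<Longrightarrow> on_ins f i = on_ins g i"
    and "\<And>x. x \<in> nodes M \<Longrightarrow> on_nodes f x = on_nodes g x"
    and "\<And>q. q \<in> outs M \<Longrightarrow> on_outs f q = on_outs g q"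
  shows "f = g"
proof -
  have "on_edges f = on_edges g"
    using assms(1,2) by (intro extensionalityI[OF _ _ assms(3)]) (auto simp: net_map_def PiE_iff)
  moreover have "on_ins f = on_ins g"
    using assms(1,2) by (intro extensionalityI[OF _ _ assms(4)]) (auto simp: net_map_def PiE_iff)
  moreover have "on_nodes f = on_nodes g"
    using assms(1,2) by (intro extensionalityI[OF _ _ assms(5)]) (auto simp: net_map_def PiE_iff)
  moreover have "on_outs f = on_outs g"
    using assms(1,2) by (intro extensionalityI[OF _ _ assms(6)]) (auto simp: net_map_def PiE_iff)
  ultimately show ?thesis by simp
qed

lemma etale_net_map: "etale M N f \<Longrightarrow> net_map M N f"
  by (simp add: etale_def)

lemmas etaleD = net_mapD[OF etale_net_map]

lemma pullback_squareI:
  assumes "\<And>x. x \<in> X' \<Longrightarrow> h x \<in> X \<and> p x \<in> T' \<and> q (h x) = g (p x)"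
    and "\<And>x x'. \<lbrakk>x \<in> X'; x' \<in> X'; p x = p x'; h x = h x'\<rbrakk> \<Longrightarrow> x = x'"
    and "\<And>t y. \<lbrakk>t \<in> T'; y \<in> X; q y = g t\<rbrakk> \<Longrightarrow> \<exists>x\<in>X'. p x = t \<and> h x = y"
  shows "pullback_square X' X T' h p q g"
  unfolding pullback_square_def bij_betw_def
proof
  show "inj_on (\<lambda>x. (h x, p x)) X'"
    using assms(2) by (auto intro: inj_onI)
  show "(\<lambda>x. (h x, p x)) ` X' = {(y, t). y \<in> X \<and> t \<in> T' \<and> q y = g t}"
    using assms(1,3) by fast
qed

lemma pullback_squareD:
  assumes "pullback_square X' X T' h p q g"
  shows "\<lbrakk>x \<in> X'; x' \<in> X'; p x = p x'; h x = h x'\<rbrakk> \<Longrightarrow> x = x'"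
    and "\<lbrakk>t \<in> T'; y \<in> X; q y = g t\<rbrakk> \<Longrightarrow> \<exists>x\<in>X'. p x = t \<and> h x = y"
proof -
  have inj: "inj_on (\<lambda>x. (h x, p x)) X'"
    and img: "(\<lambda>x. (h x, p x)) ` X' = {(y, t). y \<in> X \<and> t \<in> T' \<and> q y = g t}"
    using assms by (auto simp: pullback_square_def bij_betw_def)
  show "\<lbrakk>x \<in> X'; x' \<in> X'; p x = p x'; h x = h x'\<rbrakk> \<Longrightarrow> x = x'"
    using inj by (auto dest: inj_onD)
  assume "t \<in> T'" "y \<in> X" "q y = g t"
  then have "(y, t) \<in> (\<lambda>x. (h x, p x)) ` X'" unfolding img by simp
  then show "\<exists>x\<in>X'. p x = t \<and> h x = y" by auto
qed

text \<open>Spells out both pullback conditions as unique lifting: the arcs at a node of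
  \<open>M\<close> correspond bijectively to the arcs of \<open>N\<close> at its image. All etale
  maps below are built in this form.\<close>

lemma etaleI:
  assumes "net M" "net_map M N f"
    and "\<And>i i'. \<lbrakk>i \<in> ins M; i' \<in> ins M; in_node M i = in_node M i'; on_ins f i = on_ins f i'\<rbrakk> \<Longrightarrow> i = i'"
    and "\<And>x i. \<lbrakk>x \<in> nodes M; i \<in> ins N; in_node N i = on_nodes f x\<rbrakk> \<Longrightarrow>
      \<exists>i'\<in>ins M. in_node M i' = x \<and> on_ins f i' = i"
    and "\<And>q q'. \<lbrakk>q \<in> outs M; q' \<in> outs M; out_node M q = out_node M q'; on_outs f q = on_outs f q'\<rbrakk> \<Longrightarrow> q = q'"
    and "\<And>x q. \<lbrakk>x \<in> nodes M; q \<in> outs N; out_node N q = on_nodes f x\<rbrakk> \<Longrightarrow>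
      \<exists>q'\<in>outs M. out_node M q' = x \<and> on_outs f q' = q"
  shows "etale M N f"
  unfolding etale_def
  using assms netD[OF assms(1)] net_mapD[OF assms(2)] by (auto intro!: pullback_squareI)

lemma etale_pullbackD:
  assumes "etale M N f"
  shows "pullback_square (ins M) (ins N) (nodes M) (on_ins f) (in_node M) (in_node N) (on_nodes f)"
    "pullback_square (outs M) (outs N) (nodes M) (on_outs f) (out_node M) (out_node N) (on_nodes f)"
  using assms by (auto simp: etale_def)

lemma etale_in_inj:
  assumes "etale M N f" "i \<in> ins M" "i' \<in> ins M" "in_node M i = in_node M i'" "on_ins f i = on_ins f i'"
  shows "i = i'"
  using pullback_squareD(1)[OF etale_pullbackD(1)[OF assms(1)], OF assms(2-5)] .

lemma etale_out_inj:
  assumes "etale M N f" "q \<in> outs M" "q' \<in> outs M" "out_node M q = out_node M q'" "on_outs f q = on_outs f q'"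
  shows "q = q'"
  using pullback_squareD(1)[OF etale_pullbackD(2)[OF assms(1)], OF assms(2-5)] .

lemma etale_in_lift:
  assumes "etale M N f" "x \<in> nodes M" "i \<in> ins N" "in_node N i = on_nodes f x"
  obtains i' where "i' \<in> ins M" "in_node M i' = x" "on_ins f i' = i"
  using pullback_squareD(2)[OF etale_pullbackD(1)[OF assms(1)], OF assms(2-4)] that by blast

lemma etale_out_lift:
  assumes "etale M N f" "x \<in> nodes M" "q \<in> outs N" "out_node N q = on_nodes f x"
  obtains q' where "q' \<in> outs M" "out_node M q' = x" "on_outs f q' = q"
  using pullback_squareD(2)[OF etale_pullbackD(2)[OF assms(1)], OF assms(2-4)] that by blast

lemma on_net_comp [simp]:
  "a \<in> edges M \<Longrightarrow> on_edges (net_comp M g f) a = on_edges g (on_edges f a)"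
  "i \<in> ins M \<Longrightarrow> on_ins (net_comp M g f) i = on_ins g (on_ins f i)"
  "x \<in> nodes M \<Longrightarrow> on_nodes (net_comp M g f) x = on_nodes g (on_nodes f x)"
  "q \<in> outs M \<Longrightarrow> on_outs (net_comp M g f) q = on_outs g (on_outs f q)"
  by (simp_all add: net_comp_def compose_def)

lemma net_map_comp:
  assumes "net M" "net_map M N f" "net_map N K g"
  shows "net_map M K (net_comp M g f)"
proof -
  have "on_edges (net_comp M g f) \<in> edges M \<rightarrow>\<^sub>E edges K" "on_ins (net_comp M g f) \<in> ins M \<rightarrow>\<^sub>E ins K"
    "on_nodes (net_comp M g f) \<in> nodes M \<rightarrow>\<^sub>E nodes K" "on_outs (net_comp M g f) \<in> outs M \<rightarrow>\<^sub>E outs K"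
    using net_mapD[OF assms(2)] net_mapD[OF assms(3)]
    by (auto simp: net_comp_def compose_def)
  then show ?thesis
    unfolding net_map_def
    using netD(1-4)[OF assms(1)] net_mapD[OF assms(2)] net_mapD[OF assms(3)] by simp
qed

lemma etale_comp:
  assumes M: "net M" and f: "etale M N f" and g: "etale N K g"
  shows "etale M K (net_comp M g f)"
proof (rule etaleI[OF M net_map_comp[OF M etale_net_map[OF f] etale_net_map[OF g]]])
  fix i i' assume i: "i \<in> ins M" "i' \<in> ins M" "in_node M i = in_node M i'"
    and eq: "on_ins (net_comp M g f) i = on_ins (net_comp M g f) i'"
  have "on_ins f i = on_ins f i'"
    by (rule etale_in_inj[OF g]) (use i eq etaleD(2,6)[OF f] in auto)
  then show "i = i'" by (rule etale_in_inj[OF f i])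
next
  fix x i assume x: "x \<in> nodes M" and i: "i \<in> ins K" "in_node K i = on_nodes (net_comp M g f) x"
  obtain i1 where i1: "i1 \<in> ins N" "in_node N i1 = on_nodes f x" "on_ins g i1 = i"
    using i x etaleD(3)[OF f x] by (auto elim: etale_in_lift[OF g])
  with x obtain i2 where "i2 \<in> ins M" "in_node M i2 = x" "on_ins f i2 = i1"
    by (auto elim: etale_in_lift[OF f])
  with i1 show "\<exists>i'\<in>ins M. in_node M i' = x \<and> on_ins (net_comp M g f) i' = i" by auto
next
  fix q q' assume q: "q \<in> outs M" "q' \<in> outs M" "out_node M q = out_node M q'"
    and eq: "on_outs (net_comp M g f) q = on_outs (net_comp M g f) q'"
  have "on_outs f q = on_outs f q'"
    by (rule etale_out_inj[OF g]) (use q eq etaleD(4,7)[OF f] in auto)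
  then show "q = q'" by (rule etale_out_inj[OF f q])
next
  fix x q assume x: "x \<in> nodes M" and q: "q \<in> outs K" "out_node K q = on_nodes (net_comp M g f) x"
  obtain q1 where q1: "q1 \<in> outs N" "out_node N q1 = on_nodes f x" "on_outs g q1 = q"
    using q x etaleD(3)[OF f x] by (auto elim: etale_out_lift[OF g])
  with x obtain q2 where "q2 \<in> outs M" "out_node M q2 = x" "on_outs f q2 = q1"
    by (auto elim: etale_out_lift[OF f])
  with q1 show "\<exists>q'\<in>outs M. out_node M q' = x \<and> on_outs (net_comp M g f) q' = q" by auto
qed

lemma net_comp_assoc:
  assumes "net_map M N f"
  shows "net_comp M (net_comp N h g) f = net_comp M h (net_comp M g f)"
  using net_mapD[OF assms] by (auto simp: net_comp_def compose_def fun_eq_iff)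

section \<open>Maps under \<open>B\<close> and the two kinds of edges\<close>

lemma discrete_simps [simp]:
  "edges (discrete B) = B" "ins (discrete B) = {}" "nodes (discrete B) = {}" "outs (discrete B) = {}"
  by (simp_all add: discrete_def)

lemma net_discrete: "net (discrete B)"
  by (simp add: net_def)

text \<open>A discrete diagram has neither nodes nor arcs, so both pullback squares are
  empty.\<close>

lemma etale_discrete_iff: "etale (discrete B) N j \<longleftrightarrow> net_map (discrete B) N j"
  using etaleI[OF net_discrete] etale_net_map by fastforce

lemma B_mapD:
  assumes "B_map B H j K l f"
  shows "etale H K f" and "net_comp (discrete B) f j = l"
    and "b \<in> B \<Longrightarrow> on_edges f (on_edges j b) = on_edges l b"
  using assms by (auto simp: B_map_def)

lemma B_map_comp:
  assumes "net H" "net_map (discrete B) H j" "B_map B H j K l f" "B_map B K l L k g"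
  shows "B_map B H j L k (net_comp H g f)"
  using assms etale_comp net_comp_assoc[OF assms(2)] unfolding B_map_def by metis

lemma B_hypergraphD:
  assumes "B_hypergraph B H j"
  shows "net H" "net_map (discrete B) H j" "inj_on (out_edge H) (outs H)" "inj_on (on_edges j) B"
    "b \<in> B \<Longrightarrow> on_edges j b \<in> edges H" "b \<in> B \<Longrightarrow> on_edges j b \<notin> out_edge H ` outs H"
    "\<lbrakk>i \<in> ins H; i' \<in> ins H; in_edge H i = in_edge H i'; in_node H i = in_node H i'\<rbrakk> \<Longrightarrow> i = i'"
  using assms
  by (auto simp: B_hypergraph_def hypergraph_def forward_def etale_discrete_iff bij_betw_def
      in_boundary_def inj_on_def)

text \<open>The in-boundary is the complement of the produced edges. Nearly every claim about edges
  below is reduced by this dichotomy to the maps from \<open>B\<close> and to out-arcs.\<close>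

lemma B_hypergraph_edge_cases:
  assumes "B_hypergraph B H j" "a \<in> edges H"
  obtains (boundary) b where "b \<in> B" "a = on_edges j b"
  | (out) q where "q \<in> outs H" "a = out_edge H q"
proof -
  have "a \<in> on_edges j ` B \<or> a \<in> out_edge H ` outs H"
    using assms by (auto simp: B_hypergraph_def bij_betw_def in_boundary_def)
  then show thesis using that by blast
qed

lemma B_hypergraphI:
  assumes "hypergraph H" "forward H" "net_map (discrete B) H j" "inj_on (on_edges j) B"
    and "\<And>b. b \<in> B \<Longrightarrow> on_edges j b \<notin> out_edge H ` outs H"
    and "\<And>a. a \<in> edges H \<Longrightarrow> a \<in> on_edges j ` B \<or> a \<in> out_edge H ` outs H"
  shows "B_hypergraph B H j"
  using assms net_mapD(1)[OF assms(3)]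
  by (auto simp: B_hypergraph_def etale_discrete_iff bij_betw_def in_boundary_def)

section \<open>The precedence order of nodes and its lower sets\<close>

lemma prec_iff:
  assumes "net H"
  shows "(x, y) \<in> prec H \<longleftrightarrow>
    (\<exists>q\<in>outs H. \<exists>i\<in>ins H. out_node H q = x \<and> in_node H i = y \<and> in_edge H i = out_edge H q)"
  using netD(4)[OF assms] unfolding prec_def by fastforce

lemma prec_nodes:
  assumes "net H" "(x, y) \<in> prec H"
  shows "x \<in> nodes H" "y \<in> nodes H"
  using assms netD[OF assms(1)] by (auto simp: prec_iff)

lemma prec_rtrancl_nodes:
  assumes "net H" "y \<in> nodes H"
  shows "(x, y) \<in> (prec H)\<^sup>* \<Longrightarrow> x \<in> nodes H"
  by (erule converse_rtranclE) (use assms in \<open>auto dest: prec_nodes\<close>)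

lemma prec_map:
  assumes "net M" "net N" "net_map M N f" "(x, y) \<in> prec M"
  shows "(on_nodes f x, on_nodes f y) \<in> prec N"
proof -
  obtain q i where "q \<in> outs M" "i \<in> ins M" "out_node M q = x" "in_node M i = y"
    "in_edge M i = out_edge M q"
    using assms(4) unfolding prec_iff[OF assms(1)] by blast
  then show ?thesis
    unfolding prec_iff[OF assms(2)] using net_mapD[OF assms(3)] by metis
qed

lemma prec_rtrancl_map:
  assumes "net M" "net N" "net_map M N f" "(x, y) \<in> (prec M)\<^sup>*"
  shows "(on_nodes f x, on_nodes f y) \<in> (prec N)\<^sup>*"
  using assms(4) by induction (auto intro: rtrancl_into_rtrancl prec_map[OF assms(1-3)])

lemma prec_trancl_map:
  assumes "net M" "net N" "net_map M N f" "(x, y) \<in> (prec M)\<^sup>+"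
  shows "(on_nodes f x, on_nodes f y) \<in> (prec N)\<^sup>+"
  using assms(4) by induction (auto intro: trancl_into_trancl prec_map[OF assms(1-3)])

lemma graph_open_sub:
  assumes "net H" "X \<subseteq> nodes H"
  shows "graph (open_sub H X) \<longleftrightarrow>
    inj_on (in_edge H) {i \<in> ins H. in_node H i \<in> X} \<and> inj_on (out_edge H) {q \<in> outs H. out_node H q \<in> X}"
proof -
  have "finite {i \<in> ins H. in_node H i \<in> X \<and> in_node H i = t}"
    "finite {q \<in> outs H. out_node H q \<in> X \<and> out_node H q = t}" if "t \<in> X" for t
    using netD(5,6)[OF assms(1), of t] that assms(2) by (auto intro: rev_finite_subset)
  then have "net (open_sub H X)"
    unfolding net_def open_sub_def by auto
  then show ?thesis
    by (simp add: graph_def open_sub_def)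
qed

text \<open>Forwardness already makes the out-arcs of a principal lower set injective into edges, so
  being a graph is a condition on in-arcs alone.\<close>

lemma occurrence_hypergraph_iff:
  "occurrence_hypergraph H \<longleftrightarrow> hypergraph H \<and> forward H \<and> well_founded H \<and>
    (\<forall>y\<in>nodes H. inj_on (in_edge H) {i \<in> ins H. (in_node H i, y) \<in> (prec H)\<^sup>*})"
proof (cases "hypergraph H \<and> forward H")
  case True
  then have net: "net H" by (simp add: hypergraph_def)
  have "graph (principal_lowerset H y) \<longleftrightarrow>
      inj_on (in_edge H) {i \<in> ins H. (in_node H i, y) \<in> (prec H)\<^sup>*}" if "y \<in> nodes H" for y
    unfolding principal_lowerset_def
    using True prec_rtrancl_nodes[OF net that]
    by (subst graph_open_sub[OF net]) (auto simp: forward_def inj_on_def)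
  with True show ?thesis by (simp add: occurrence_hypergraph_def)
qed (auto simp: occurrence_hypergraph_def)

section \<open>Maps that are injective on edges and nodes\<close>

text \<open>Arcs are left out because, for an etale map, injectivity on nodes together with unique
  lifting gives injectivity on both kinds of arcs.\<close>

definition net_inj :: "('a, 'i, 'n, 'o) net \<Rightarrow> ('a, 'i, 'n, 'o, 'a2, 'i2, 'n2, 'o2) net_map \<Rightarrow> bool" where
  "net_inj M f \<longleftrightarrow> inj_on (on_edges f) (edges M) \<and> inj_on (on_nodes f) (nodes M)"

lemma etale_net_inj:
  assumes "net M" "etale M N e" "net_inj M e"
  shows "inj_on (on_edges e) (edges M)" "inj_on (on_nodes e) (nodes M)"
    "inj_on (on_ins e) (ins M)" "inj_on (on_outs e) (outs M)"
proof -
  show "inj_on (on_edges e) (edges M)" and n: "inj_on (on_nodes e) (nodes M)"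
    using assms(3) by (simp_all add: net_inj_def)
  show "inj_on (on_ins e) (ins M)"
  proof (rule inj_onI)
    fix i i' assume i: "i \<in> ins M" "i' \<in> ins M" "on_ins e i = on_ins e i'"
    then have "in_node M i = in_node M i'"
      using inj_onD[OF n] netD(2)[OF assms(1)] etaleD(6)[OF assms(2)] by metis
    then show "i = i'" using i by (intro etale_in_inj[OF assms(2)])
  qed
  show "inj_on (on_outs e) (outs M)"
  proof (rule inj_onI)
    fix q q' assume q: "q \<in> outs M" "q' \<in> outs M" "on_outs e q = on_outs e q'"
    then have "out_node M q = out_node M q'"
      using inj_onD[OF n] netD(3)[OF assms(1)] etaleD(7)[OF assms(2)] by metis
    then show "q = q'" using q by (intro etale_out_inj[OF assms(2)])
  qed
qed

lemma net_inj_monic: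
  assumes "net S" "etale S N e" "net_inj S e" "net_map M S g" "net_map M S g'"
    and "net_comp M e g = net_comp M e g'"
  shows "g = g'"
proof (rule net_map_eqI[OF assms(4,5)])
  note inj = etale_net_inj[OF assms(1-3)] and g = net_mapD[OF assms(4)] and g' = net_mapD[OF assms(5)]
  show "on_edges g a = on_edges g' a" if "a \<in> edges M" for a
    using inj_onD[OF inj(1)] g(1) g'(1) that assms(6) by (metis on_net_comp(1))
  show "on_ins g a = on_ins g' a" if "a \<in> ins M" for a
    using inj_onD[OF inj(3)] g(2) g'(2) that assms(6) by (metis on_net_comp(2))
  show "on_nodes g a = on_nodes g' a" if "a \<in> nodes M" for a
    using inj_onD[OF inj(2)] g(3) g'(3) that assms(6) by (metis on_net_comp(3))
  show "on_outs g a = on_outs g' a" if "a \<in> outs M" for a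
    using inj_onD[OF inj(4)] g(4) g'(4) that assms(6) by (metis on_net_comp(4))
qed

text \<open>An image condition on nodes is enough. Arcs of \<open>M\<close> are hit because
  \<open>e\<close> lifts arcs at every node it reaches; a token edge is hit because both maps are
  under \<open>B\<close>, and a produced edge because its out-arc is. Every identity required of
  \<open>g\<close> is checked after composing with the injective \<open>e\<close>.\<close>

lemma net_inj_factor:
  assumes M: "B_hypergraph B M k" and S: "B_hypergraph B S j"
    and e: "B_map B S j N l e" "net_inj S e" and f: "B_map B M k N l f"
    and img: "on_nodes f ` nodes M \<subseteq> on_nodes e ` nodes S"
  obtains g where "B_map B M k S j g" "net_comp M e g = f"
proof -
  note netM = B_hypergraphD(1)[OF M] and netS = B_hypergraphD(1)[OF S]
  note e' = B_mapD(1)[OF e(1)] and f' = B_mapD(1)[OF f]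
  note inj = etale_net_inj[OF netS e' e(2)]
  have lift_nodes: "\<exists>y\<in>nodes S. on_nodes e y = on_nodes f x" if "x \<in> nodes M" for x
    using img that by (metis imageE imageI subsetD)
  have lift_ins: "\<exists>i'\<in>ins S. on_ins e i' = on_ins f i" if "i \<in> ins M" for i
    using lift_nodes[of "in_node M i"] netD(2)[OF netM that] etaleD(2,6)[OF f' that]
    by (metis etale_in_lift[OF e'])
  have lift_outs: "\<exists>q'\<in>outs S. on_outs e q' = on_outs f q" if "q \<in> outs M" for q
    using lift_nodes[of "out_node M q"] netD(3)[OF netM that] etaleD(4,7)[OF f' that]
    by (metis etale_out_lift[OF e'])
  have lift_edges: "\<exists>a'\<in>edges S. on_edges e a' = on_edges f a" if "a \<in> edges M" for a
    using M that
  proof (cases rule: B_hypergraph_edge_cases)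
    case (boundary b)
    then show ?thesis
      using B_mapD(3)[OF e(1)] B_mapD(3)[OF f] B_hypergraphD(5)[OF S] by metis
  next
    case (out q)
    then show ?thesis
      using lift_outs[of q] etaleD(8)[OF f'] etaleD(8)[OF e'] netD(4)[OF netS] by metis
  qed
  define g where "g = \<lparr>
    on_edges = (\<lambda>a\<in>edges M. inv_into (edges S) (on_edges e) (on_edges f a)),
    on_ins = (\<lambda>a\<in>ins M. inv_into (ins S) (on_ins e) (on_ins f a)),
    on_nodes = (\<lambda>a\<in>nodes M. inv_into (nodes S) (on_nodes e) (on_nodes f a)),
    on_outs = (\<lambda>a\<in>outs M. inv_into (outs S) (on_outs e) (on_outs f a))\<rparr>"
  have ge: "on_edges g a \<in> edges S" "on_edges e (on_edges g a) = on_edges f a" if "a \<in> edges M" for a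
    using lift_edges[OF that] that by (auto simp: g_def intro!: inv_into_into f_inv_into_f)
  have gi: "on_ins g a \<in> ins S" "on_ins e (on_ins g a) = on_ins f a" if "a \<in> ins M" for a
    using lift_ins[OF that] that by (auto simp: g_def intro!: inv_into_into f_inv_into_f)
  have gn: "on_nodes g a \<in> nodes S" "on_nodes e (on_nodes g a) = on_nodes f a" if "a \<in> nodes M" for a
    using lift_nodes[OF that] that by (auto simp: g_def intro!: inv_into_into f_inv_into_f)
  have go: "on_outs g a \<in> outs S" "on_outs e (on_outs g a) = on_outs f a" if "a \<in> outs M" for a
    using lift_outs[OF that] that by (auto simp: g_def intro!: inv_into_into f_inv_into_f)
  have map: "net_map M S g"
    unfolding net_map_def
  proof (intro conjI ballI)
    show "on_edges g \<in> edges M \<rightarrow>\<^sub>E edges S" "on_ins g \<in> ins M \<rightarrow>\<^sub>E ins S"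
      "on_nodes g \<in> nodes M \<rightarrow>\<^sub>E nodes S" "on_outs g \<in> outs M \<rightarrow>\<^sub>E outs S"
      using ge(1) gi(1) gn(1) go(1) by (auto simp: g_def)
  next
    fix i assume i: "i \<in> ins M"
    note m = netD(1,2)[OF netM i]
    show "in_edge S (on_ins g i) = on_edges g (in_edge M i)"
      by (rule inj_onD[OF inj(1)])
        (use gi[OF i] ge[OF m(1)] etaleD(5)[OF f' i] etaleD(5)[OF e' gi(1)[OF i]] netD(1)[OF netS] in auto)
    show "in_node S (on_ins g i) = on_nodes g (in_node M i)"
      by (rule inj_onD[OF inj(2)])
        (use gi[OF i] gn[OF m(2)] etaleD(6)[OF f' i] etaleD(6)[OF e' gi(1)[OF i]] netD(2)[OF netS] in auto)
  next
    fix q assume q: "q \<in> outs M"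
    note m = netD(3,4)[OF netM q]
    show "out_node S (on_outs g q) = on_nodes g (out_node M q)"
      by (rule inj_onD[OF inj(2)])
        (use go[OF q] gn[OF m(1)] etaleD(7)[OF f' q] etaleD(7)[OF e' go(1)[OF q]] netD(3)[OF netS] in auto)
    show "out_edge S (on_outs g q) = on_edges g (out_edge M q)"
      by (rule inj_onD[OF inj(1)])
        (use go[OF q] ge[OF m(2)] etaleD(8)[OF f' q] etaleD(8)[OF e' go(1)[OF q]] netD(4)[OF netS] in auto)
  qed
  have et: "etale M S g"
  proof (rule etaleI[OF netM map])
    fix i i' assume i: "i \<in> ins M" "i' \<in> ins M" "in_node M i = in_node M i'" "on_ins g i = on_ins g i'"
    then have "on_ins f i = on_ins f i'" using gi(2) by metis
    then show "i = i'" by (rule etale_in_inj[OF f' i(1-3)])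
  next
    fix x i assume x: "x \<in> nodes M" and i: "i \<in> ins S" "in_node S i = on_nodes g x"
    have "in_node N (on_ins e i) = on_nodes f x"
      using etaleD(6)[OF e' i(1)] i gn(2)[OF x] by simp
    then obtain i' where i': "i' \<in> ins M" "in_node M i' = x" "on_ins f i' = on_ins e i"
      using x etaleD(2)[OF e' i(1)] by (elim etale_in_lift[OF f', rotated -1])
    have "on_ins g i' = i"
      by (rule inj_onD[OF inj(3)]) (use i' gi[OF i'(1)] i in auto)
    then show "\<exists>i'\<in>ins M. in_node M i' = x \<and> on_ins g i' = i" using i' by blast
  next
    fix q q' assume q: "q \<in> outs M" "q' \<in> outs M" "out_node M q = out_node M q'" "on_outs g q = on_outs g q'"
    then have "on_outs f q = on_outs f q'" using go(2) by metis
    then show "q = q'" by (rule etale_out_inj[OF f' q(1-3)])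
  next
    fix x q assume x: "x \<in> nodes M" and q: "q \<in> outs S" "out_node S q = on_nodes g x"
    have "out_node N (on_outs e q) = on_nodes f x"
      using etaleD(7)[OF e' q(1)] q gn(2)[OF x] by simp
    then obtain q' where q': "q' \<in> outs M" "out_node M q' = x" "on_outs f q' = on_outs e q"
      using x etaleD(4)[OF e' q(1)] by (elim etale_out_lift[OF f', rotated -1])
    have "on_outs g q' = q"
      by (rule inj_onD[OF inj(4)]) (use q' go[OF q'(1)] q in auto)
    then show "\<exists>q'\<in>outs M. out_node M q' = x \<and> on_outs g q' = q" using q' by blast
  qed
  note nk = B_hypergraphD(2)[OF M] and nj = B_hypergraphD(2)[OF S]
  have eg: "net_comp M e g = f"
    by (rule net_map_eqI[OF net_map_comp[OF netM map etale_net_map[OF e']] etale_net_map[OF f']])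
      (use ge gi gn go in auto)
  have "net_comp (discrete B) e (net_comp (discrete B) g k) = net_comp (discrete B) e j"
    using net_comp_assoc[OF nk, of e g] eg B_mapD(2)[OF f] B_mapD(2)[OF e(1)] by simp
  then have "net_comp (discrete B) g k = j"
    by (intro net_inj_monic[OF netS e' e(2) net_map_comp[OF net_discrete nk map] nj])
  then show thesis using that et eg by (simp add: B_map_def)
qed

text \<open>Paths of \<open>M\<close> are carried to paths of \<open>H\<close>. A cycle in
  \<open>M\<close> would therefore give one in \<open>H\<close>, and injectivity on nodes and
  in-arcs embeds each lower set of \<open>M\<close>, with its in-arcs, into one of
  \<open>H\<close>.\<close>

lemma occurrence_hypergraph_reflect:
  assumes M: "hypergraph M" "forward M" and H: "occurrence_hypergraph H"
    and e: "etale M H e" "net_inj M e"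
  shows "occurrence_hypergraph M"
proof -
  have netM: "net M" and netH: "net H"
    using M(1) H by (auto simp: hypergraph_def occurrence_hypergraph_def)
  note inj = etale_net_inj[OF netM e]
  note lower = prec_rtrancl_map[OF netM netH etale_net_map[OF e(1)]]
  have "irrefl ((prec M)\<^sup>+)"
    using H prec_trancl_map[OF netM netH etale_net_map[OF e(1)]]
    by (auto simp: occurrence_hypergraph_def well_founded_def irrefl_def)
  moreover have "finite {x. (x, y) \<in> (prec M)\<^sup>*}" if y: "y \<in> nodes M" for y
  proof (rule inj_on_finite)
    show "inj_on (on_nodes e) {x. (x, y) \<in> (prec M)\<^sup>*}"
      using inj(2) prec_rtrancl_nodes[OF netM y] by (auto intro: inj_on_subset)
    show "on_nodes e ` {x. (x, y) \<in> (prec M)\<^sup>*} \<subseteq> {x. (x, on_nodes e y) \<in> (prec H)\<^sup>*}"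
      using lower by auto
    show "finite {x. (x, on_nodes e y) \<in> (prec H)\<^sup>*}"
      using H etaleD(3)[OF e(1) y] by (auto simp: occurrence_hypergraph_def well_founded_def)
  qed
  moreover have "inj_on (in_edge M) {i \<in> ins M. (in_node M i, y) \<in> (prec M)\<^sup>*}"
    if y: "y \<in> nodes M" for y
  proof (rule inj_onI)
    fix i i' assume i: "i \<in> {i \<in> ins M. (in_node M i, y) \<in> (prec M)\<^sup>*}"
      "i' \<in> {i \<in> ins M. (in_node M i, y) \<in> (prec M)\<^sup>*}" "in_edge M i = in_edge M i'"
    have "inj_on (in_edge H) {i \<in> ins H. (in_node H i, on_nodes e y) \<in> (prec H)\<^sup>*}"
      using H etaleD(3)[OF e(1) y] by (simp add: occurrence_hypergraph_iff)
    then have "on_ins e i = on_ins e i'"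
      by (rule inj_onD) (use i lower etaleD(2,5,6)[OF e(1)] in auto)
    then show "i = i'" using i inj_onD[OF inj(3)] by blast
  qed
  ultimately show ?thesis
    using M by (simp add: occurrence_hypergraph_iff well_founded_def)
qed

section \<open>Copies of lower sets on the natural numbers\<close>

lemma countable_fibres:
  assumes "countable X" "\<And>x. x \<in> X \<Longrightarrow> finite {i \<in> I. h i = x}"
  shows "countable {i \<in> I. h i \<in> X}"
proof -
  have "{i \<in> I. h i \<in> X} = (\<Union>x\<in>X. {i \<in> I. h i = x})" by auto
  then show ?thesis using assms by (simp add: countable_finite)
qed

text \<open>The copy keeps all of the in-boundary of H, not only the edges incident to X.\<close>

lemma lower_set_copy:
  fixes H :: "('a, 'i, 'n, 'o) net"
  assumes H: "B_hypergraph B H j" and B: "countable B"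
    and X: "X \<subseteq> nodes H" "countable X" and lower: "\<And>x y. \<lbrakk>(x, y) \<in> prec H; y \<in> X\<rbrakk> \<Longrightarrow> x \<in> X"
  obtains M :: nnet and k e
  where "B_hypergraph B M k" "B_map B M k H j e" "net_inj M e" "on_nodes e ` nodes M = X"
    "finite B \<Longrightarrow> finite X \<Longrightarrow> finite_net M"
proof -
  note netH = B_hypergraphD(1)[OF H] and nj = B_hypergraphD(2)[OF H]
  define I where "I = {i \<in> ins H. in_node H i \<in> X}"
  define Q where "Q = {q \<in> outs H. out_node H q \<in> X}"
  define A where "A = on_edges j ` B \<union> out_edge H ` Q"
  have fI: "\<And>x. x \<in> X \<Longrightarrow> finite {i \<in> ins H. in_node H i = x}"
    and fQ: "\<And>x. x \<in> X \<Longrightarrow> finite {q \<in> outs H. out_node H q = x}"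
    using netD(5,6)[OF netH] X by auto
  have cI: "countable I" and cQ: "countable Q"
    unfolding I_def Q_def by (intro countable_fibres X fI fQ; assumption)+
  then have cA: "countable A" using B by (simp add: A_def)
  have AH: "A \<subseteq> edges H"
    using net_mapD(1)[OF nj] netD(4)[OF netH] by (auto simp: A_def Q_def)
  \<comment> \<open>Here \<open>X\<close> must be closed downwards: a produced edge consumed at a
    node of \<open>X\<close> has its producer in \<open>X\<close>, so it belongs to
    \<open>A\<close>.\<close>
  have IA: "in_edge H i \<in> A" if "i \<in> I" for i
  proof -
    have i: "i \<in> ins H" "in_node H i \<in> X" using that by (auto simp: I_def)
    from H netD(1)[OF netH i(1)] show ?thesis
    proof (cases rule: B_hypergraph_edge_cases)
      case (out q)
      then have "(out_node H q, in_node H i) \<in> prec H"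
        using i by (auto simp: prec_iff[OF netH])
      then show ?thesis using out i lower by (auto simp: A_def Q_def)
    qed (simp add: A_def)
  qed
  have QA: "out_edge H q \<in> A" if "q \<in> Q" for q using that by (simp add: A_def)
  define M :: nnet where "M = \<lparr> edges = to_nat_on A ` A, ins = to_nat_on I ` I, nodes = to_nat_on X ` X,
     outs = to_nat_on Q ` Q,
     in_edge = \<lambda>i. to_nat_on A (in_edge H (from_nat_into I i)),
     in_node = \<lambda>i. to_nat_on X (in_node H (from_nat_into I i)),
     out_node = \<lambda>q. to_nat_on X (out_node H (from_nat_into Q q)),
     out_edge = \<lambda>q. to_nat_on A (out_edge H (from_nat_into Q q))\<rparr>"
  define e where "e = \<lparr> on_edges = restrict (from_nat_into A) (edges M),
     on_ins = restrict (from_nat_into I) (ins M), on_nodes = restrict (from_nat_into X) (nodes M),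
     on_outs = restrict (from_nat_into Q) (outs M)\<rparr>"
  define k :: "('b, unit, unit, unit, nat, nat, nat, nat) net_map" where "k = \<lparr> on_edges = (\<lambda>b\<in>B. to_nat_on A (on_edges j b)),
     on_ins = (\<lambda>i\<in>{}. undefined), on_nodes = (\<lambda>i\<in>{}. undefined), on_outs = (\<lambda>i\<in>{}. undefined)\<rparr>"
  have "{i \<in> to_nat_on I ` I. to_nat_on X (in_node H (from_nat_into I i)) = to_nat_on X x}
      = to_nat_on I ` {i \<in> ins H. in_node H i = x}"
    "{q \<in> to_nat_on Q ` Q. to_nat_on X (out_node H (from_nat_into Q q)) = to_nat_on X x}
      = to_nat_on Q ` {q \<in> outs H. out_node H q = x}" if "x \<in> X" for x
    using that cI cQ X by (auto simp: I_def Q_def)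
  then have netM: "net M"
    using IA QA cI cQ fI fQ by (auto simp: net_def M_def I_def Q_def)
  have mapE: "net_map M H e"
    using cA cI cQ X AH IA QA unfolding net_map_def
    by (auto simp: e_def M_def I_def Q_def)
  have et: "etale M H e"
  proof (rule etaleI[OF netM mapE])
    show "\<exists>i'\<in>ins M. in_node M i' = x \<and> on_ins e i' = i"
      if "x \<in> nodes M" "i \<in> ins H" "in_node H i = on_nodes e x" for x i
      using that cI X by (intro bexI[of _ "to_nat_on I i"]) (auto simp: M_def e_def I_def)
    show "\<exists>q'\<in>outs M. out_node M q' = x \<and> on_outs e q' = q"
      if "x \<in> nodes M" "q \<in> outs H" "out_node H q = on_nodes e x" for x q
      using that cQ X by (intro bexI[of _ "to_nat_on Q q"]) (auto simp: M_def e_def Q_def)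
  qed (use cI cQ in \<open>auto simp: M_def e_def\<close>)
  have inj: "net_inj M e"
    using cA X by (auto simp: net_inj_def M_def e_def inj_on_def)
  have jA: "on_edges j b \<in> A" if "b \<in> B" for b using that by (simp add: A_def)
  have mapK: "net_map (discrete B) M k"
    using jA by (auto simp: net_map_def k_def M_def)
  have ek: "net_comp (discrete B) e k = j"
    by (rule net_map_eqI[OF net_map_comp[OF net_discrete mapK mapE] nj])
      (use jA cA in \<open>auto simp: e_def k_def M_def\<close>)
  have hyp: "hypergraph M"
    unfolding hypergraph_def inj_on_def
  proof (intro conjI ballI impI netM; clarify)
    fix i i' assume i: "i \<in> ins M" "i' \<in> ins M" "in_edge M i = in_edge M i'" "in_node M i = in_node M i'"
    then have "on_ins e i = on_ins e i'"
      using B_hypergraphD(7)[OF H] etaleD(2,5,6)[OF et] by metis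
    then show "i = i'" using etale_in_inj[OF et] i by blast
  next
    fix q q' assume q: "q \<in> outs M" "q' \<in> outs M" "out_node M q = out_node M q'" "out_edge M q = out_edge M q'"
    then have "on_outs e q = on_outs e q'"
      using inj_onD[OF B_hypergraphD(3)[OF H]] etaleD(4,8)[OF et] by metis
    then show "q = q'" using etale_out_inj[OF et] q by blast
  qed
  have fwd: "forward M"
    unfolding forward_def
  proof (rule inj_onI)
    fix q q' assume q: "q \<in> outs M" "q' \<in> outs M" "out_edge M q = out_edge M q'"
    then have "on_outs e q = on_outs e q'"
      using inj_onD[OF B_hypergraphD(3)[OF H]] etaleD(4,8)[OF et] by metis
    then show "q = q'" using q inj_onD[OF etale_net_inj(4)[OF netM et inj]] by blast
  qed
  have BM: "B_hypergraph B M k"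
  proof (rule B_hypergraphI[OF hyp fwd mapK])
    have "on_edges e (on_edges k b) = on_edges j b" if "b \<in> B" for b
      using that by (simp flip: ek)
    then show "inj_on (on_edges k) B"
      using B_hypergraphD(4)[OF H] by (auto simp: inj_on_def) metis
    show "on_edges k b \<notin> out_edge M ` outs M" if b: "b \<in> B" for b
    proof
      assume "on_edges k b \<in> out_edge M ` outs M"
      then obtain q where "q \<in> outs M" "on_edges k b = out_edge M q" by auto
      then have "on_edges j b = out_edge H (on_outs e q)" "on_outs e q \<in> outs H"
        using etaleD(4,8)[OF et] b by (auto simp flip: ek)
      then show False using B_hypergraphD(6)[OF H b] by auto
    qed
    show "a \<in> on_edges k ` B \<or> a \<in> out_edge M ` outs M" if "a \<in> edges M" for a
      using that cQ by (auto simp: M_def k_def A_def image_image cong: image_cong_simp)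
  qed
  show thesis
  proof (rule that[OF BM _ inj])
    show "B_map B M k H j e" using et ek by (simp add: B_map_def)
    show "on_nodes e ` nodes M = X" using X by (auto simp: e_def M_def image_image)
    assume fin: "finite B" "finite X"
    have "I = (\<Union>x\<in>X. {i \<in> ins H. in_node H i = x})" "Q = (\<Union>x\<in>X. {q \<in> outs H. out_node H q = x})"
      by (auto simp: I_def Q_def)
    then have "finite I" "finite Q" using fin fI fQ by auto
    then show "finite_net M" using fin netM by (auto simp: finite_net_def M_def A_def)
  qed
qed

section \<open>Unfoldings are colimits of processes\<close>

lemma is_unfoldingD:
  assumes "is_unfolding P B m H j p"
  shows "B_hypergraph B H j" "net H" "net_map (discrete B) H j" "etale H P p"
    "net_comp (discrete B) p j = m" "occurrence_hypergraph H"
  using assms B_hypergraphD(1,2) by (auto simp: is_unfolding_def)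

text \<open>A finite acyclic graph satisfies the occurrence conditions globally: injectivity of the
  outer maps gives forwardness and the two relation properties, and finiteness bounds the lower
  sets.\<close>

lemma process_is_unfolding:
  assumes "is_process P B m G k p"
  shows "is_unfolding P B m G k p"
proof -
  have G: "finite_net G" "graph G" "acyclic (prec G)" using assms by (auto simp: is_process_def)
  then have net: "net G" by (simp add: graph_def)
  have hyp: "hypergraph G" and fwd: "forward G"
    using G(2) by (auto simp: hypergraph_def forward_def graph_def inj_on_def)
  have "finite {x. (x, y) \<in> (prec G)\<^sup>*}" if "y \<in> nodes G" for y
    using G(1) prec_rtrancl_nodes[OF net that]
    by (auto simp: finite_net_def intro: rev_finite_subset)
  moreover have "inj_on (in_edge G) {i \<in> ins G. (in_node G i, y) \<in> (prec G)\<^sup>*}" for y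
    using G(2) by (auto simp: graph_def intro: inj_on_subset)
  ultimately have "occurrence_hypergraph G"
    using hyp fwd G(3) by (auto simp: occurrence_hypergraph_iff well_founded_def irrefl_def acyclic_def)
  then show ?thesis
    using assms hyp fwd by (auto simp: is_process_def is_unfolding_def B_hypergraph_def)
qed

lemma unfolding_reflect:
  assumes H: "is_unfolding P B m H j p" and M: "B_hypergraph B M k"
    and e: "B_map B M k H j e" "net_inj M e"
  shows "is_unfolding P B m M k (net_comp M p e)"
proof -
  note netM = B_hypergraphD(1)[OF M] and e' = B_mapD(1)[OF e(1)]
  have "occurrence_hypergraph M"
    using M by (intro occurrence_hypergraph_reflect[OF _ _ is_unfoldingD(6)[OF H] e' e(2)])
      (auto simp: B_hypergraph_def)
  moreover have "etale M P (net_comp M p e)"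
    by (rule etale_comp[OF netM e' is_unfoldingD(4)[OF H]])
  moreover have "net_comp (discrete B) (net_comp M p e) k = m"
    by (simp add: net_comp_assoc[OF B_hypergraphD(2)[OF M]] B_mapD(2)[OF e(1)] is_unfoldingD(5)[OF H])
  ultimately show ?thesis using M by (simp add: is_unfolding_def)
qed

text \<open>Well-foundedness makes the lower set finite, hence so is its copy with all tokens added.
  Tokens that are not consumed below \<open>y\<close> carry no in-arcs, so the copy is still a graph
  because the principal lower set of \<open>y\<close> is one.\<close>

lemma lowerset_process:
  assumes H: "is_unfolding P B m H j p" and B: "finite B" and y: "y \<in> nodes H"
  obtains G :: nnet and k e
  where "is_process P B m G k (net_comp G p e)" "B_map B G k H j e" "net_inj G e"
    "on_nodes e ` nodes G = {x. (x, y) \<in> (prec H)\<^sup>*}"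
proof -
  let ?X = "{x. (x, y) \<in> (prec H)\<^sup>*}"
  note netH = is_unfoldingD(2)[OF H]
  have sub: "?X \<subseteq> nodes H" using prec_rtrancl_nodes[OF netH y] by auto
  have fin: "finite ?X"
    using is_unfoldingD(6)[OF H] y by (auto simp: occurrence_hypergraph_def well_founded_def)
  have "\<And>x z. \<lbrakk>(x, z) \<in> prec H; z \<in> ?X\<rbrakk> \<Longrightarrow> x \<in> ?X"
    by (auto intro: converse_rtrancl_into_rtrancl)
  then obtain M :: nnet and k e where M: "B_hypergraph B M k" "B_map B M k H j e" "net_inj M e"
    "on_nodes e ` nodes M = ?X" "finite_net M"
    using lower_set_copy[OF is_unfoldingD(1)[OF H] countable_finite[OF B] sub countable_finite[OF fin]]
      B fin by metis
  note U = unfolding_reflect[OF H M(1-3)] and e = B_mapD(1)[OF M(2)]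
  note netM = B_hypergraphD(1)[OF M(1)]
  have "inj_on (in_edge M) (ins M)"
  proof (rule inj_onI)
    fix i i' assume i: "i \<in> ins M" "i' \<in> ins M" "in_edge M i = in_edge M i'"
    have "inj_on (in_edge H) {i \<in> ins H. in_node H i \<in> ?X}"
      using is_unfoldingD(6)[OF H] y by (simp add: occurrence_hypergraph_iff)
    moreover have "in_node H (on_ins e i) \<in> ?X" if "i \<in> ins M" for i
      using netD(2)[OF netM that] etaleD(6)[OF e that] M(4) by auto
    ultimately have "on_ins e i = on_ins e i'"
      by (elim inj_onD) (use i etaleD(2,5)[OF e] in auto)
    then show "i = i'" using i inj_onD[OF etale_net_inj(3)[OF netM e M(3)]] by blast
  qed
  then have "graph M"
    using netM B_hypergraphD(3)[OF M(1)] by (simp add: graph_def)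
  moreover have "acyclic (prec M)"
    using is_unfoldingD(6)[OF U]
    by (auto simp: occurrence_hypergraph_def well_founded_def irrefl_def acyclic_def)
  ultimately have "is_process P B m M k (net_comp M p e)"
    using M(1,5) U by (auto simp: is_process_def is_unfolding_def B_hypergraph_def)
  then show thesis using that M by blast
qed

lemma process_mapD:
  assumes "process_map B G k p G' k' p' h"
  shows "B_map B G k G' k' h" "etale G G' h" "net_comp G p' h = p"
  using assms by (auto simp: process_map_def B_map_def)

lemma process_coconeD:
  assumes "process_cocone P B m K l c"
  shows "B_hypergraph B K l" "is_process P B m G k p \<Longrightarrow> B_map B G k K l (c G k p)"
    "\<lbrakk>is_process P B m G k p; is_process P B m G' k' p'; process_map B G k p G' k' p' h\<rbrakk> \<Longrightarrow>
      net_comp G (c G' k' p') h = c G k p"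
  using assms unfolding process_cocone_def by blast+

section \<open>Gluing maps out of an unfolding from its processes\<close>

text \<open>Each node, with all arcs at it, lies in the image of its own lower-set process. An edge
  is then settled by \<open>eq_B\<close> or by its out-arc. The target \<open>N\<close> is an
  arbitrary net and the maps need not be etale, so that the lemma also separates maps into
  \<open>P\<close>.\<close>

lemma process_maps_jointly_epic:
  assumes B: "finite B" and H: "is_unfolding P B m H j p"
    and v: "net_map H N v" "net_map H N v'"
    and eq_B: "net_comp (discrete B) v j = net_comp (discrete B) v' j"
    and eq: "\<And>(G :: nnet) k q f. \<lbrakk>is_process P B m G k q; process_map B G k q H j p f\<rbrakk> \<Longrightarrow>
      net_comp G v f = net_comp G v' f"
  shows "v = v'"
proof (rule net_map_eqI[OF v])
  note netH = is_unfoldingD(2)[OF H]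
  have local: "on_nodes v x = on_nodes v' x"
    "\<lbrakk>i \<in> ins H; in_node H i = x\<rbrakk> \<Longrightarrow> on_ins v i = on_ins v' i"
    "\<lbrakk>r \<in> outs H; out_node H r = x\<rbrakk> \<Longrightarrow> on_outs v r = on_outs v' r" if x: "x \<in> nodes H" for x i r
  proof -
    obtain G :: nnet and k f where G: "is_process P B m G k (net_comp G p f)" "B_map B G k H j f"
      "net_inj G f" "on_nodes f ` nodes G = {z. (z, x) \<in> (prec H)\<^sup>*}"
      by (rule lowerset_process[OF H B x])
    note f = B_mapD(1)[OF G(2)]
    have vf: "net_comp G v f = net_comp G v' f"
      using eq[OF G(1)] G(2) by (simp add: process_map_def)
    have "x \<in> on_nodes f ` nodes G" by (simp add: G(4))
    then obtain s where s: "s \<in> nodes G" "on_nodes f s = x" by auto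
    show "on_nodes v x = on_nodes v' x"
      using on_net_comp(3)[OF s(1), of _ f] vf s(2) by metis
    show "on_ins v i = on_ins v' i" if "i \<in> ins H" "in_node H i = x"
      using etale_in_lift[OF f s(1) that(1)] on_net_comp(2)[of _ G _ f] vf s(2) that by metis
    show "on_outs v r = on_outs v' r" if "r \<in> outs H" "out_node H r = x"
      using etale_out_lift[OF f s(1) that(1)] on_net_comp(4)[of _ G _ f] vf s(2) that by metis
  qed
  show "on_nodes v x = on_nodes v' x" if "x \<in> nodes H" for x using local(1)[OF that] .
  show "on_ins v i = on_ins v' i" if "i \<in> ins H" for i
    using local(2)[OF netD(2)[OF netH that] that refl] .
  show outs: "on_outs v r = on_outs v' r" if "r \<in> outs H" for r
    using local(3)[OF netD(3)[OF netH that] that refl] .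
  show "on_edges v a = on_edges v' a" if "a \<in> edges H" for a
    using is_unfoldingD(1)[OF H] that
  proof (cases rule: B_hypergraph_edge_cases)
    case (boundary b)
    then show ?thesis using eq_B on_net_comp(1)[of b "discrete B" _ j] by (metis discrete_simps(1))
  next
    case (out r)
    then show ?thesis using outs net_mapD(8)[OF v(1)] net_mapD(8)[OF v(2)] by metis
  qed
qed

text \<open>The lower set M of y in G also maps to any process E covering the lower set of the image of y,
  so naturality of the cocone along M compares the legs at G and at E.\<close>

lemma cocone_compare:
  assumes B: "finite B" and H: "is_unfolding P B m H j p" and K: "process_cocone P B m K l d"
    and E: "is_process P B m E kE (net_comp E p e)" "B_map B E kE H j e" "net_inj E e"
      "on_nodes e ` nodes E = {z. (z, x) \<in> (prec H)\<^sup>*}"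
    and G: "is_process P B m G k q" "process_map B G k q H j p f" and y: "y \<in> nodes G" "on_nodes f y = x"
  obtains M :: nnet and h g z where "net_map M E g" "etale M G h"
    "net_comp M e g = net_comp M f h"
    "net_comp M (d E kE (net_comp E p e)) g = net_comp M (d G k q) h"
    "z \<in> nodes M" "on_nodes h z = y"
proof -
  note UG = process_is_unfolding[OF G(1)] and UE = process_is_unfolding[OF E(1)]
  note f = process_mapD[OF G(2)]
  note netG = is_unfoldingD(2)[OF UG] and netH = is_unfoldingD(2)[OF H] and netE = is_unfoldingD(2)[OF UE]
  obtain M :: nnet and kM h where
    M: "is_process P B m M kM (net_comp M q h)" "B_map B M kM G k h" "net_inj M h"
      "on_nodes h ` nodes M = {x. (x, y) \<in> (prec G)\<^sup>*}"
    by (rule lowerset_process[OF UG B y(1)])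
  note UM = process_is_unfolding[OF M(1)]
  note netM = is_unfoldingD(2)[OF UM] and h = B_mapD(1)[OF M(2)]
  have fh: "B_map B M kM H j (net_comp M f h)"
    by (rule B_map_comp[OF netM is_unfoldingD(3)[OF UM] M(2) f(1)])
  \<comment> \<open>Nodes below \<open>y\<close> in \<open>G\<close> go to nodes below
    \<open>x\<close> in \<open>H\<close>, which is the image condition of
    \<open>net_inj_factor\<close>.\<close>
  have "on_nodes (net_comp M f h) ` nodes M \<subseteq> on_nodes e ` nodes E"
  proof
    fix w assume "w \<in> on_nodes (net_comp M f h) ` nodes M"
    then obtain v where "v \<in> nodes M" "w = on_nodes f (on_nodes h v)" by auto
    then show "w \<in> on_nodes e ` nodes E"
      unfolding E(4) using y(2) M(4) prec_rtrancl_map[OF netG netH etale_net_map[OF f(2)]] by auto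
  qed
  then obtain g where g: "B_map B M kM E kE g" "net_comp M e g = net_comp M f h"
    by (rule net_inj_factor[OF is_unfoldingD(1)[OF UM] is_unfoldingD(1)[OF UE] E(2,3) fh])
  note g' = etale_net_map[OF B_mapD(1)[OF g(1)]]
  have "net_comp M (net_comp E p e) g = net_comp M q h"
    using net_comp_assoc[OF g'] net_comp_assoc[OF etale_net_map[OF h]] g(2) f(3) by metis
  then have pg: "process_map B M kM (net_comp M q h) E kE (net_comp E p e) g"
    using g(1) by (simp add: process_map_def)
  have ph: "process_map B M kM (net_comp M q h) G k q h"
    using M(2) by (simp add: process_map_def)
  have "net_comp M (d E kE (net_comp E p e)) g = net_comp M (d G k q) h"
    using process_coconeD(3)[OF K M(1) E(1) pg] process_coconeD(3)[OF K M(1) G(1) ph] by simp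
  moreover have "y \<in> on_nodes h ` nodes M" by (simp add: M(4))
  ultimately show thesis using that[OF g' h g(2)] by auto
qed

text \<open>The diagram consists of the processes with a map to \<open>H\<close>; the legs come from
  a cocone on all processes and do not depend on that map. The values of \<open>u\<close> at a node
  and its arcs are read off from one chosen lower-set process. Once they are known to be independent
  of the choice, the conditions on \<open>u\<close> at a node can be checked inside that single
  process.\<close>

theorem unfolding_colimit:
  fixes H :: "('a, 'i, 'n, 'o) net" and K :: "('a2, 'i2, 'n2, 'o2) net"
  assumes B: "finite B" and H: "is_unfolding P B m H j p" and K: "process_cocone P B m K l d"
  shows "\<exists>!u. B_map B H j K l u \<and> (\<forall>G k q f. is_process P B m G k q \<longrightarrow>
    process_map B G k q H j p f \<longrightarrow> net_comp G u f = d G k q)"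
proof -
  note netH = is_unfoldingD(2)[OF H] and BH = is_unfoldingD(1)[OF H] and nj = is_unfoldingD(3)[OF H]
  note BK = process_coconeD(1)[OF K]
  note netK = B_hypergraphD(1)[OF BK] and nl = B_hypergraphD(2)[OF BK]
  define R where "R y G k e \<longleftrightarrow> is_process P B m G k (net_comp G p e) \<and> B_map B G k H j e \<and>
    net_inj G e \<and> on_nodes e ` nodes G = {x. (x, y) \<in> (prec H)\<^sup>*}" for y and G :: nnet and k e
  have "\<exists>G k e. R y G k e" if "y \<in> nodes H" for y
    by (rule lowerset_process[OF H B that]) (auto simp: R_def)
  then obtain E kE e where "\<And>y. y \<in> nodes H \<Longrightarrow> R y (E y) (kE y) (e y)"
    by metis
  then have E: "is_process P B m (E y) (kE y) (net_comp (E y) p (e y))" "B_map B (E y) (kE y) H j (e y)"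
    "net_inj (E y) (e y)" "on_nodes (e y) ` nodes (E y) = {x. (x, y) \<in> (prec H)\<^sup>*}"
    if "y \<in> nodes H" for y
    using that unfolding R_def by blast+
  define D where "D y = d (E y) (kE y) (net_comp (E y) p (e y))" for y
  have netE: "net (E y)" if "y \<in> nodes H" for y
    using is_unfoldingD(2)[OF process_is_unfolding[OF E(1)[OF that]]] .
  have eE: "etale (E y) H (e y)" if "y \<in> nodes H" for y using B_mapD(1)[OF E(2)[OF that]] .
  have pE: "process_map B (E y) (kE y) (net_comp (E y) p (e y)) H j p (e y)" if "y \<in> nodes H" for y
    using E(2)[OF that] by (simp add: process_map_def)
  have DK: "etale (E y) K (D y)" if "y \<in> nodes H" for y
    using B_mapD(1)[OF process_coconeD(2)[OF K E(1)[OF that]]] by (simp add: D_def)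
  have injE: "inj_on (on_nodes (e y)) (nodes (E y))" "inj_on (on_ins (e y)) (ins (E y))"
    "inj_on (on_outs (e y)) (outs (E y))" if "y \<in> nodes H" for y
    using etale_net_inj[OF netE[OF that] eE[OF that] E(3)[OF that]] by blast+

  \<comment> \<open>\<open>e x\<close> is injective and its image contains \<open>x\<close> and all
    arcs at \<open>x\<close>, so each value is that of the leg \<open>D x\<close> at a unique
    preimage.\<close>
  define un where "un x = on_nodes (D x) (inv_into (nodes (E x)) (on_nodes (e x)) x)" for x
  define ui where "ui i = on_ins (D (in_node H i))
    (inv_into (ins (E (in_node H i))) (on_ins (e (in_node H i))) i)" for i
  define uo where "uo q = on_outs (D (out_node H q))
    (inv_into (outs (E (out_node H q))) (on_outs (e (out_node H q))) q)" for q
  \<comment> \<open>No process is consulted for edges: forwardness recovers the out-arc of a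
    produced edge, and the remaining edges come from \<open>B\<close>. This makes the square on
    \<open>out_edge\<close> and the compatibility with \<open>j\<close> hold by definition.\<close>
  define ue where "ue a = (if a \<in> out_edge H ` outs H
    then out_edge K (uo (inv_into (outs H) (out_edge H) a))
    else on_edges l (inv_into B (on_edges j) a))" for a
  have ue_out: "ue (out_edge H q) = out_edge K (uo q)" if "q \<in> outs H" for q
    using that B_hypergraphD(3)[OF BH] by (simp add: ue_def)
  have ue_j: "ue (on_edges j b) = on_edges l b" if "b \<in> B" for b
    using that B_hypergraphD(4,6)[OF BH] by (simp add: ue_def)

  \<comment> \<open>Independence of the choice: any process over \<open>H\<close> that reaches
    \<open>x\<close> yields the values read off from \<open>E x\<close>. The common sub-process
    \<open>M\<close> contains a node over \<open>y\<close>, and the arcs at \<open>y\<close> lift to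
    it.\<close>
  have agree: "on_nodes (d G k q) y = un (on_nodes f y)"
    "\<And>i. \<lbrakk>i \<in> ins G; in_node G i = y\<rbrakk> \<Longrightarrow> on_ins (d G k q) i = ui (on_ins f i)"
    "\<And>r. \<lbrakk>r \<in> outs G; out_node G r = y\<rbrakk> \<Longrightarrow> on_outs (d G k q) r = uo (on_outs f r)"
    if G: "is_process P B m G k q" "process_map B G k q H j p f" and y: "y \<in> nodes G" for G k q f y
  proof -
    define x where "x = on_nodes f y"
    note f = process_mapD(2)[OF G(2)]
    have x: "x \<in> nodes H" using etaleD(3)[OF f y] by (simp add: x_def)
    obtain M :: nnet and h g z where M: "net_map M (E x) g" "etale M G h"
      "net_comp M (e x) g = net_comp M f h"
      "net_comp M (D x) g = net_comp M (d G k q) h" "z \<in> nodes M" "on_nodes h z = y"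
      by (rule cocone_compare[OF B H K E[OF x] G y x_def[symmetric], folded D_def])
    have "on_nodes (e x) (on_nodes g z) = x" "on_nodes (D x) (on_nodes g z) = on_nodes (d G k q) y"
      using M(3-6) on_net_comp(3)[of z M] by (metis x_def)+
    then show "on_nodes (d G k q) y = un (on_nodes f y)"
      using inv_into_f_eq[OF injE(1)[OF x]] net_mapD(3)[OF M(1,5)] by (simp add: un_def x_def)
    show "on_ins (d G k q) i = ui (on_ins f i)" if i: "i \<in> ins G" "in_node G i = y" for i
    proof -
      obtain i' where i': "i' \<in> ins M" "on_ins h i' = i"
        using etale_in_lift[OF M(2,5) i(1)] i(2) M(6) by metis
      then have "on_ins (e x) (on_ins g i') = on_ins f i" "on_ins (D x) (on_ins g i') = on_ins (d G k q) i"
        using M(3,4) on_net_comp(2)[of i' M] by metis+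
      moreover have "in_node H (on_ins f i) = x" using etaleD(6)[OF f i(1)] i by (simp add: x_def)
      ultimately show ?thesis
        using inv_into_f_eq[OF injE(2)[OF x]] net_mapD(2)[OF M(1) i'(1)] by (simp add: ui_def)
    qed
    show "on_outs (d G k q) r = uo (on_outs f r)" if r: "r \<in> outs G" "out_node G r = y" for r
    proof -
      obtain r' where r': "r' \<in> outs M" "on_outs h r' = r"
        using etale_out_lift[OF M(2,5) r(1)] r(2) M(6) by metis
      then have "on_outs (e x) (on_outs g r') = on_outs f r" "on_outs (D x) (on_outs g r') = on_outs (d G k q) r"
        using M(3,4) on_net_comp(4)[of r' M] by metis+
      moreover have "out_node H (on_outs f r) = x" using etaleD(7)[OF f r(1)] r by (simp add: x_def)
      ultimately show ?thesis
        using inv_into_f_eq[OF injE(3)[OF x]] net_mapD(4)[OF M(1) r'(1)] by (simp add: uo_def)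
    qed
  qed
  have agree_edges: "on_edges (d G k q) a = ue (on_edges f a)"
    if G: "is_process P B m G k q" "process_map B G k q H j p f" and a: "a \<in> edges G" for G k q f a
  proof -
    note UG = process_is_unfolding[OF G(1)] and f = process_mapD(1,2)[OF G(2)]
    note c = process_coconeD(2)[OF K G(1)]
    from is_unfoldingD(1)[OF UG] a show ?thesis
    proof (cases rule: B_hypergraph_edge_cases)
      case (boundary b)
      then show ?thesis using ue_j B_mapD(3)[OF c] B_mapD(3)[OF f(1)] by simp
    next
      case (out r)
      then show ?thesis
        using etaleD(8)[OF B_mapD(1)[OF c] out(1)] etaleD(4,8)[OF f(2) out(1)] ue_out
          agree(3)[OF G netD(3)[OF is_unfoldingD(2)[OF UG] out(1)] out(1)] by metis
    qed
  qed

  have cover: "\<exists>s\<in>nodes (E x). on_nodes (e x) s = x \<and> on_nodes (D x) s = un x"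
    if x: "x \<in> nodes H" for x
  proof -
    have "x \<in> on_nodes (e x) ` nodes (E x)" unfolding E(4)[OF x] by simp
    then obtain s where "s \<in> nodes (E x)" "on_nodes (e x) s = x" by auto
    then show ?thesis using agree(1)[OF E(1)[OF x] pE[OF x], of s] by (auto simp: D_def)
  qed
  define u where "u = \<lparr>on_edges = restrict ue (edges H), on_ins = restrict ui (ins H),
    on_nodes = restrict un (nodes H), on_outs = restrict uo (outs H)\<rparr>"
  have in_cover: "\<exists>i'\<in>ins (E x). in_node (E x) i' = s \<and> on_ins (e x) i' = i \<and> on_ins (D x) i' = ui i"
    if x: "x \<in> nodes H" and s: "s \<in> nodes (E x)" "on_nodes (e x) s = x"
      and i: "i \<in> ins H" "in_node H i = x" for x s i
  proof -
    obtain i' where "i' \<in> ins (E x)" "in_node (E x) i' = s" "on_ins (e x) i' = i"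
      using etale_in_lift[OF eE[OF x] s(1) i(1)] i s by metis
    then show ?thesis using agree(2)[OF E(1)[OF x] pE[OF x] s(1), of i'] by (auto simp: D_def)
  qed
  have out_cover: "\<exists>r'\<in>outs (E x). out_node (E x) r' = s \<and> on_outs (e x) r' = r \<and> on_outs (D x) r' = uo r"
    if x: "x \<in> nodes H" and s: "s \<in> nodes (E x)" "on_nodes (e x) s = x"
      and r: "r \<in> outs H" "out_node H r = x" for x s r
  proof -
    obtain r' where "r' \<in> outs (E x)" "out_node (E x) r' = s" "on_outs (e x) r' = r"
      using etale_out_lift[OF eE[OF x] s(1) r(1)] r s by metis
    then show ?thesis using agree(3)[OF E(1)[OF x] pE[OF x] s(1), of r'] by (auto simp: D_def)
  qed
  have un: "un x \<in> nodes K" if "x \<in> nodes H" for x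
    using cover[OF that] etaleD(3)[OF DK[OF that]] by metis
  \<comment> \<open>The square on \<open>in_edge\<close> is the delicate one: a produced edge
    consumed at \<open>x\<close> has its value defined through the lower set of its producer, not
    that of \<open>x\<close>. \<open>agree_edges\<close> reconciles the two inside
    \<open>E x\<close>.\<close>
  have ui: "ui i \<in> ins K" "in_node K (ui i) = un (in_node H i)" "in_edge K (ui i) = ue (in_edge H i)"
    if i: "i \<in> ins H" for i
  proof -
    define x where "x = in_node H i"
    have x: "x \<in> nodes H" using netD(2)[OF netH i] by (simp add: x_def)
    obtain s where s: "s \<in> nodes (E x)" "on_nodes (e x) s = x" "on_nodes (D x) s = un x"
      using cover[OF x] by blast
    obtain i' where i': "i' \<in> ins (E x)" "in_node (E x) i' = s" "on_ins (e x) i' = i" "on_ins (D x) i' = ui i"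
      using in_cover[OF x s(1,2) i] by (auto simp: x_def)
    show "ui i \<in> ins K" "in_node K (ui i) = un (in_node H i)"
      using etaleD(2,6)[OF DK[OF x] i'(1)] i' s by (auto simp: x_def)
    have "ue (in_edge H i) = ue (on_edges (e x) (in_edge (E x) i'))"
      using etaleD(5)[OF eE[OF x] i'(1)] i'(3) by simp
    also have "\<dots> = on_edges (D x) (in_edge (E x) i')"
      using agree_edges[OF E(1)[OF x] pE[OF x] netD(1)[OF netE[OF x] i'(1)]] by (simp add: D_def)
    also have "\<dots> = in_edge K (ui i)"
      using etaleD(5)[OF DK[OF x] i'(1)] i'(4) by simp
    finally show "in_edge K (ui i) = ue (in_edge H i)" ..
  qed
  have uo: "uo r \<in> outs K" "out_node K (uo r) = un (out_node H r)" if r: "r \<in> outs H" for r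
  proof -
    define x where "x = out_node H r"
    have x: "x \<in> nodes H" using netD(3)[OF netH r] by (simp add: x_def)
    obtain s where s: "s \<in> nodes (E x)" "on_nodes (e x) s = x" "on_nodes (D x) s = un x"
      using cover[OF x] by blast
    obtain r' where "r' \<in> outs (E x)" "out_node (E x) r' = s" "on_outs (D x) r' = uo r"
      using out_cover[OF x s(1,2) r] by (auto simp: x_def)
    then show "uo r \<in> outs K" "out_node K (uo r) = un (out_node H r)"
      using etaleD(4,7)[OF DK[OF x], of r'] s by (auto simp: x_def)
  qed
  have ue: "ue a \<in> edges K" if "a \<in> edges H" for a
    using BH that
  proof (cases rule: B_hypergraph_edge_cases)
    case (boundary b)
    then show ?thesis using ue_j B_hypergraphD(5)[OF BK] by simp
  next
    case (out r)
    then show ?thesis using ue_out uo(1) netD(4)[OF netK] by simp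
  qed
  have map: "net_map H K u"
    using ue ui uo un ue_out netD(1-4)[OF netH] by (auto simp: net_map_def u_def)
  \<comment> \<open>Lifting at \<open>x\<close> is inherited from \<open>E x\<close>, where both
    \<open>e x\<close> and \<open>D x\<close> are etale.\<close>
  have "etale H K u"
  proof (rule etaleI[OF netH map])
    fix i1 i2 assume i: "i1 \<in> ins H" "i2 \<in> ins H" "in_node H i1 = in_node H i2" "on_ins u i1 = on_ins u i2"
    then have x: "in_node H i1 \<in> nodes H" using netD(2)[OF netH] by simp
    obtain s where s: "s \<in> nodes (E (in_node H i1))" "on_nodes (e (in_node H i1)) s = in_node H i1"
      using cover[OF x] by blast
    obtain i1' where 1: "i1' \<in> ins (E (in_node H i1))" "in_node (E (in_node H i1)) i1' = s"
      "on_ins (e (in_node H i1)) i1' = i1" "on_ins (D (in_node H i1)) i1' = ui i1"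
      using in_cover[OF x s i(1)] by auto
    obtain i2' where 2: "i2' \<in> ins (E (in_node H i1))" "in_node (E (in_node H i1)) i2' = s"
      "on_ins (e (in_node H i1)) i2' = i2" "on_ins (D (in_node H i1)) i2' = ui i2"
      using in_cover[OF x s i(2)] i(3) by auto
    have "i1' = i2'"
      by (rule etale_in_inj[OF DK[OF x] 1(1) 2(1)]) (use 1 2 i in \<open>auto simp: u_def\<close>)
    then show "i1 = i2" using 1(3) 2(3) by simp
  next
    fix r1 r2 assume r: "r1 \<in> outs H" "r2 \<in> outs H" "out_node H r1 = out_node H r2" "on_outs u r1 = on_outs u r2"
    then have x: "out_node H r1 \<in> nodes H" using netD(3)[OF netH] by simp
    obtain s where s: "s \<in> nodes (E (out_node H r1))" "on_nodes (e (out_node H r1)) s = out_node H r1"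
      using cover[OF x] by blast
    obtain r1' where 1: "r1' \<in> outs (E (out_node H r1))" "out_node (E (out_node H r1)) r1' = s"
      "on_outs (e (out_node H r1)) r1' = r1" "on_outs (D (out_node H r1)) r1' = uo r1"
      using out_cover[OF x s r(1)] by auto
    obtain r2' where 2: "r2' \<in> outs (E (out_node H r1))" "out_node (E (out_node H r1)) r2' = s"
      "on_outs (e (out_node H r1)) r2' = r2" "on_outs (D (out_node H r1)) r2' = uo r2"
      using out_cover[OF x s r(2)] r(3) by auto
    have "r1' = r2'"
      by (rule etale_out_inj[OF DK[OF x] 1(1) 2(1)]) (use 1 2 r in \<open>auto simp: u_def\<close>)
    then show "r1 = r2" using 1(3) 2(3) by simp
  next
    fix x i assume x: "x \<in> nodes H" and i: "i \<in> ins K" "in_node K i = on_nodes u x"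
    obtain s where s: "s \<in> nodes (E x)" "on_nodes (e x) s = x" "on_nodes (D x) s = un x"
      using cover[OF x] by blast
    have "in_node K i = on_nodes (D x) s" using i s x by (simp add: u_def)
    then obtain i' where i': "i' \<in> ins (E x)" "in_node (E x) i' = s" "on_ins (D x) i' = i"
      by (rule etale_in_lift[OF DK[OF x] s(1) i(1)])
    have "on_ins u (on_ins (e x) i') = i"
      using agree(2)[OF E(1)[OF x] pE[OF x] s(1) i'(1,2)] i' etaleD(2)[OF eE[OF x] i'(1)]
      by (simp add: D_def u_def)
    then show "\<exists>i'\<in>ins H. in_node H i' = x \<and> on_ins u i' = i"
      using etaleD(2,6)[OF eE[OF x] i'(1)] i' s by auto
  next
    fix x r assume x: "x \<in> nodes H" and r: "r \<in> outs K" "out_node K r = on_nodes u x"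
    obtain s where s: "s \<in> nodes (E x)" "on_nodes (e x) s = x" "on_nodes (D x) s = un x"
      using cover[OF x] by blast
    have "out_node K r = on_nodes (D x) s" using r s x by (simp add: u_def)
    then obtain r' where r': "r' \<in> outs (E x)" "out_node (E x) r' = s" "on_outs (D x) r' = r"
      by (rule etale_out_lift[OF DK[OF x] s(1) r(1)])
    have "on_outs u (on_outs (e x) r') = r"
      using agree(3)[OF E(1)[OF x] pE[OF x] s(1) r'(1,2)] r' etaleD(4)[OF eE[OF x] r'(1)]
      by (simp add: D_def u_def)
    then show "\<exists>r'\<in>outs H. out_node H r' = x \<and> on_outs u r' = r"
      using etaleD(4,7)[OF eE[OF x] r'(1)] r' s by auto
  qed
  moreover have "net_comp (discrete B) u j = l"
    by (rule net_map_eqI[OF net_map_comp[OF net_discrete nj map] nl])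
      (use ue_j B_hypergraphD(5)[OF BH] in \<open>auto simp: u_def\<close>)
  ultimately have uB: "B_map B H j K l u" by (simp add: B_map_def)
  have comp: "net_comp G u f = d G k q"
    if G: "is_process P B m G k q" "process_map B G k q H j p f" for G k q f
  proof -
    note netG = is_unfoldingD(2)[OF process_is_unfolding[OF G(1)]] and f = process_mapD(2)[OF G(2)]
    show ?thesis
    proof (rule net_map_eqI[OF net_map_comp[OF netG etale_net_map[OF f] map]
          etale_net_map[OF B_mapD(1)[OF process_coconeD(2)[OF K G(1)]]]])
    qed (use agree(1)[OF G] agree(2)[OF G _ _ refl] agree(3)[OF G _ _ refl] agree_edges[OF G]
        netD(2,3)[OF netG] etaleD(1-4)[OF f] in
        \<open>auto simp: u_def\<close>)
  qed
  show ?thesis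
  proof (rule ex1I[of _ u])
    show "B_map B H j K l u \<and> (\<forall>G k q f. is_process P B m G k q \<longrightarrow>
      process_map B G k q H j p f \<longrightarrow> net_comp G u f = d G k q)"
      using uB comp by blast
    fix v assume v: "B_map B H j K l v \<and> (\<forall>G k q f. is_process P B m G k q \<longrightarrow>
      process_map B G k q H j p f \<longrightarrow> net_comp G v f = d G k q)"
    then have vB: "B_map B H j K l v" by blast
    show "v = u"
      using v comp B_mapD(2)[OF vB] B_mapD(2)[OF uB]
      by (intro process_maps_jointly_epic[OF B H etale_net_map[OF B_mapD(1)[OF vB]] map]) auto
  qed
qed

text \<open>The number of strict predecessors is a rank. It is finite, and it grows along
  \<open>(x, y)\<close> because \<open>x\<close> is a strict predecessor of \<open>y\<close> but, by
  irreflexivity, not of itself.\<close>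

lemma wf_prec:
  assumes "occurrence_hypergraph H"
  shows "wf (prec H)"
proof -
  have net: "net H" and irr: "irrefl ((prec H)\<^sup>+)"
    and fin: "\<And>y. y \<in> nodes H \<Longrightarrow> finite {x. (x, y) \<in> (prec H)\<^sup>*}"
    using assms by (auto simp: occurrence_hypergraph_def hypergraph_def well_founded_def)
  have "card {z. (z, x) \<in> (prec H)\<^sup>+} < card {z. (z, y) \<in> (prec H)\<^sup>+}" if xy: "(x, y) \<in> prec H" for x y
  proof (rule psubset_card_mono)
    show "finite {z. (z, y) \<in> (prec H)\<^sup>+}"
      using fin[OF prec_nodes(2)[OF net xy]] by (rule rev_finite_subset) auto
    show "{z. (z, x) \<in> (prec H)\<^sup>+} \<subset> {z. (z, y) \<in> (prec H)\<^sup>+}"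
      using xy irr by (auto simp: irrefl_def intro: trancl_into_trancl)
  qed
  then have "prec H \<subseteq> measure (\<lambda>x. card {z. (z, x) \<in> (prec H)\<^sup>+})" by auto
  then show ?thesis by (rule wf_subset[OF wf_measure])
qed

section \<open>Universal unfoldings and colimits\<close>

lemma universal_unfoldingD:
  fixes H :: "('a, 'e, 'n, 'r) net"
  assumes "universal_unfolding TYPE(('a, 'e, 'n, 'r) net) P B m U j \<epsilon>"
  shows "is_unfolding P B m U j \<epsilon>"
    "is_unfolding P B m H k p \<Longrightarrow> \<exists>!f. B_map B H k U j f \<and> net_comp H \<epsilon> f = p"
  using assms unfolding universal_unfolding_def by blast+

text \<open>Natural-number test objects include all processes of the diagram, so each has exactly
  one map to \<open>U\<close> over \<open>P\<close>, and uniqueness turns these maps into a cocone.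
  For \<open>H\<close> on arbitrary carriers, being a map over \<open>P\<close> is rephrased as
  restricting to these legs, and \<open>unfolding_colimit\<close> yields exactly one such map.
  Applied to \<open>U\<close> itself, the same theorem is the colimit property.\<close>

lemma universal_unfolding_colimit:
  fixes U :: "('a1, 'e1, 'n1, 'r1) net"
  assumes B: "finite B" and U: "universal_unfolding TYPE(nnet) P B m U j \<epsilon>"
  shows "universal_unfolding TYPE(('a, 'e, 'n, 'r) net) P B m U j \<epsilon> \<and>
    (\<exists>c. process_colimit TYPE(('a, 'e, 'n, 'r) net) P B m U j c \<and>
      (\<forall>G k p. is_process P B m G k p \<longrightarrow> net_comp G \<epsilon> (c G k p) = p))"
proof -
  note uU = universal_unfoldingD(1)[OF U]
  note e = is_unfoldingD(4)[OF uU]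
  define c where "c G k p = (THE f. process_map B G k p U j \<epsilon> f)" for G :: nnet and k p
  have c: "process_map B G k p U j \<epsilon> f \<longleftrightarrow> f = c G k p" if "is_process P B m G k p" for G k p f
  proof -
    have "\<exists>!f. process_map B G k p U j \<epsilon> f"
      using universal_unfoldingD(2)[OF U process_is_unfolding[OF that]] by (simp add: process_map_def)
    then show ?thesis unfolding c_def by (metis the1_equality)
  qed
  then have leg: "process_map B G k p U j \<epsilon> (c G k p)" if "is_process P B m G k p" for G :: nnet and k p
    using that by blast
  have comp_over: "process_map B G k q U j \<epsilon> (net_comp G u f)"
    if G: "is_unfolding P B m G k q" and f: "process_map B G k q H l p f"
      and u: "process_map B H l p U j \<epsilon> u" for G :: nnet and H :: "('a5, 'e5, 'n5, 'r5) net" and k q l p f u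
  proof -
    have "net_comp G \<epsilon> (net_comp G u f) = q"
      using net_comp_assoc[OF etale_net_map[OF process_mapD(2)[OF f]], of \<epsilon> u]
        process_mapD(3)[OF u] process_mapD(3)[OF f] by simp
    then show ?thesis
      using B_map_comp[OF is_unfoldingD(2,3)[OF G] process_mapD(1)[OF f] process_mapD(1)[OF u]]
      by (simp add: process_map_def)
  qed
  have cocone: "process_cocone P B m U j c"
    unfolding process_cocone_def
  proof (intro conjI allI impI; (elim conjE)?)
    show "B_hypergraph B U j" by (rule is_unfoldingD(1)[OF uU])
    show "B_map B G k U j (c G k p)" if "is_process P B m G k p" for G :: nnet and k p
      by (rule process_mapD(1)[OF leg[OF that]])
    show "net_comp G (c G' k' p') h = c G k p"
      if "is_process P B m G k p" "is_process P B m G' k' p'" "process_map B G k p G' k' p' h"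
      for G G' :: nnet and k p k' p' h
      using comp_over[OF process_is_unfolding[OF that(1)] that(3) leg[OF that(2)]] c[OF that(1)] by blast
  qed
  have "\<exists>!u. B_map B H l U j u \<and> net_comp H \<epsilon> u = p"
    if H: "is_unfolding P B m H l p" for H :: "('a, 'e, 'n, 'r) net" and l p
  proof -
    \<comment> \<open>From left to right, the legs are unique. From right to left, the two maps from
      \<open>H\<close> to \<open>P\<close> agree on every process over \<open>H\<close>, hence are
      equal by joint epimorphy.\<close>
    have over_iff: "B_map B H l U j u \<Longrightarrow> net_comp H \<epsilon> u = p \<longleftrightarrow> (\<forall>G k q f. is_process P B m G k q \<longrightarrow>
        process_map B G k q H l p f \<longrightarrow> net_comp G u f = c G k q)" for u
    proof (intro iffI allI impI)
      fix G :: nnet and k q f assume u: "B_map B H l U j u" "net_comp H \<epsilon> u = p" and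
        G: "is_process P B m G k q" "process_map B G k q H l p f"
      then have "process_map B H l p U j \<epsilon> u" by (simp add: process_map_def)
      then show "net_comp G u f = c G k q"
        using comp_over[OF process_is_unfolding[OF G(1)] G(2)] c[OF G(1)] by blast
    next
      assume u: "B_map B H l U j u" and
        uc: "\<forall>G k q f. is_process P B m G k q \<longrightarrow>
          process_map B G k q H l p f \<longrightarrow> net_comp G u f = c G k q"
      note u' = B_mapD(1)[OF u]
      have map: "net_map H P (net_comp H \<epsilon> u)"
        by (rule net_map_comp[OF is_unfoldingD(2)[OF H] etale_net_map[OF u'] etale_net_map[OF e]])
      show "net_comp H \<epsilon> u = p"
      proof (rule process_maps_jointly_epic[OF B H map etale_net_map[OF is_unfoldingD(4)[OF H]]])
        show "net_comp (discrete B) (net_comp H \<epsilon> u) l = net_comp (discrete B) p l"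
          by (simp add: net_comp_assoc[OF is_unfoldingD(3)[OF H]] B_mapD(2)[OF u]
              is_unfoldingD(5)[OF uU] is_unfoldingD(5)[OF H])
        fix G :: nnet and k q f assume G: "is_process P B m G k q" "process_map B G k q H l p f"
        have "net_comp G (net_comp H \<epsilon> u) f = net_comp G \<epsilon> (c G k q)"
          using uc G by (simp add: net_comp_assoc[OF etale_net_map[OF process_mapD(2)[OF G(2)]]])
        also have "\<dots> = net_comp G p f"
          using process_mapD(3)[OF G(2)] process_mapD(3)[OF leg[OF G(1)]] by simp
        finally show "net_comp G (net_comp H \<epsilon> u) f = net_comp G p f" .
      qed
    qed
    show ?thesis
      using unfolding_colimit[OF B H cocone] by (simp add: over_iff cong: conj_cong)
  qed
  then have "universal_unfolding TYPE(('a, 'e, 'n, 'r) net) P B m U j \<epsilon>"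
    using uU by (simp add: universal_unfolding_def)
  moreover have "process_colimit TYPE(('a, 'e, 'n, 'r) net) P B m U j c"
    unfolding process_colimit_def
  proof (intro conjI allI impI cocone)
    fix K :: "('a, 'e, 'n, 'r) net" and l d
    assume K: "process_cocone P B m K l d"
    \<comment> \<open>The leg is the only map from a process to \<open>U\<close> over
      \<open>P\<close>, so the quantifier over \<open>f\<close> collapses.\<close>
    have "(\<forall>G k q f. is_process P B m G k q \<longrightarrow> process_map B G k q U j \<epsilon> f \<longrightarrow> net_comp G u f = d G k q)
      \<longleftrightarrow> (\<forall>G k p. is_process P B m G k p \<longrightarrow> net_comp G u (c G k p) = d G k p)" for u
      by (simp add: c)
    then show "\<exists>!u. B_map B U j K l u \<and>
        (\<forall>G k p. is_process P B m G k p \<longrightarrow> net_comp G u (c G k p) = d G k p)"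
      using unfolding_colimit[OF B uU K] by simp
  qed
  moreover have "net_comp G \<epsilon> (c G k p) = p" if "is_process P B m G k p" for G :: nnet and k p
    by (rule process_mapD(3)[OF leg[OF that]])
  ultimately show ?thesis by blast
qed

section \<open>Construction of the universal unfolding\<close>

text \<open>An event is a transition together with the assignment of a condition to each of its
  in-arcs; a condition is a token of the initial marking or an out-arc of an event.\<close>

datatype ('b, 'i, 't, 'o) cond = Init 'b | Out 't "'i \<Rightarrow> ('b, 'i, 't, 'o) cond" 'o

type_synonym ('b, 'i, 't, 'o) event = "'t \<times> ('i \<Rightarrow> ('b, 'i, 't, 'o) cond)"

locale marked_net =
  fixes P :: "('s, 'i, 't, 'o) net" and B :: "'b set"
    and m :: "('b, unit, unit, unit, 's, 'i, 't, 'o) net_map"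
  assumes finite_net: "finite_net P" and grounded: "grounded P"
    and finite_B: "finite B" and marking: "marking P B m"
begin

definition pre :: "'t \<Rightarrow> 'i set" where
  "pre t = {i \<in> ins P. in_node P i = t}"

definition place :: "('b, 'i, 't, 'o) cond \<Rightarrow> 's" where
  "place c = (case c of Init b \<Rightarrow> on_edges m b | Out t \<phi> q \<Rightarrow> out_edge P q)"

text \<open>The bound \<open>pre (fst y)\<close> keeps values of the assignment off its domain from
  counting as causes, and makes the relation finitely branching.\<close>

definition causes :: "('b, 'i, 't, 'o) event rel" where
  "causes = {(x, y). \<exists>i\<in>pre (fst y). \<exists>q. snd y i = Out (fst x) (snd x) q}"

text \<open>A local check: the histories of the producers are left to \<open>events\<close>.
  Extensionality makes equality of events mean equality of their assignments on in-arcs.\<close>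

definition enabled :: "('b, 'i, 't, 'o) event \<Rightarrow> bool" where
  "enabled x \<longleftrightarrow> fst x \<in> nodes P \<and> snd x \<in> extensional (pre (fst x)) \<and>
    (\<forall>i\<in>pre (fst x). place (snd x i) = in_edge P i \<and>
      (case snd x i of Init b \<Rightarrow> b \<in> B | Out t \<phi> q \<Rightarrow> q \<in> outs P \<and> out_node P q = t))"

text \<open>No condition is consumed by two in-arcs within the history of \<open>y\<close>, which is
  the graph condition on principal lower sets. The case \<open>x = x'\<close> forbids one event to
  use a condition twice.\<close>

definition conflict_free :: "('b, 'i, 't, 'o) event \<Rightarrow> bool" where
  "conflict_free y \<longleftrightarrow> (\<forall>x x' i i'. (x, y) \<in> causes\<^sup>* \<longrightarrow> (x', y) \<in> causes\<^sup>* \<longrightarrow>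
    i \<in> pre (fst x) \<longrightarrow> i' \<in> pre (fst x') \<longrightarrow> snd x i = snd x' i' \<longrightarrow> x = x' \<and> i = i')"

definition events :: "('b, 'i, 't, 'o) event set" where
  "events = {y. (\<forall>x. (x, y) \<in> causes\<^sup>* \<longrightarrow> enabled x) \<and> conflict_free y}"

text \<open>An arc is an event paired with an arc of \<open>P\<close> at its transition, so the
  projection to \<open>P\<close> lifts arcs uniquely by construction.\<close>

definition unf :: "(('b, 'i, 't, 'o) cond, ('b, 'i, 't, 'o) event \<times> 'i, ('b, 'i, 't, 'o) event,
    ('b, 'i, 't, 'o) event \<times> 'o) net" where
  "unf = \<lparr> edges = Init ` B \<union> {Out (fst x) (snd x) q |x q. x \<in> events \<and> q \<in> outs P \<and> out_node P q = fst x},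
     ins = {(x, i). x \<in> events \<and> i \<in> pre (fst x)}, nodes = events,
     outs = {(x, q). x \<in> events \<and> q \<in> outs P \<and> out_node P q = fst x},
     in_edge = \<lambda>(x, i). snd x i, in_node = fst, out_node = fst,
     out_edge = \<lambda>(x, q). Out (fst x) (snd x) q\<rparr>"

definition unf_init :: "('b, unit, unit, unit, ('b, 'i, 't, 'o) cond, ('b, 'i, 't, 'o) event \<times> 'i,
    ('b, 'i, 't, 'o) event, ('b, 'i, 't, 'o) event \<times> 'o) net_map" where
  "unf_init = \<lparr> on_edges = restrict Init B, on_ins = (\<lambda>_\<in>{}. undefined),
     on_nodes = (\<lambda>_\<in>{}. undefined), on_outs = (\<lambda>_\<in>{}. undefined)\<rparr>"

definition unf_fold :: "(('b, 'i, 't, 'o) cond, ('b, 'i, 't, 'o) event \<times> 'i, ('b, 'i, 't, 'o) event,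
    ('b, 'i, 't, 'o) event \<times> 'o, 's, 'i, 't, 'o) net_map" where
  "unf_fold = \<lparr> on_edges = restrict place (edges unf), on_ins = restrict snd (ins unf),
     on_nodes = restrict fst (nodes unf), on_outs = restrict snd (outs unf)\<rparr>"

section \<open>The causal order on events\<close>

lemma netP: "net P" and finite_pre: "finite (pre t)"
  using finite_net by (auto simp: finite_net_def pre_def)

lemma marking_map: "net_map (discrete B) P m"
  using marking by (simp add: marking_def etale_discrete_iff)

lemma pre_nonempty:
  assumes "t \<in> nodes P"
  shows "\<exists>i. i \<in> pre t"
proof -
  have "t \<in> in_node P ` ins P" using assms grounded by (simp add: grounded_def)
  then show ?thesis by (auto simp: pre_def)
qed

text \<open>A cause of an event is a subterm of its assignment, so accessibility follows by
  structural induction on conditions.\<close>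

lemma wf_causes: "wf causes"
proof (rule acc_wfI, rule allI)
  have "(case c of Init b \<Rightarrow> True | Out t \<phi> q \<Rightarrow> (t, \<phi>) \<in> Wellfounded.acc causes)" for c
  proof (induction c)
    case (Out t \<phi> q)
    have "x \<in> Wellfounded.acc causes" if "(x, (t, \<phi>)) \<in> causes" for x
    proof -
      obtain i q' where "\<phi> i = Out (fst x) (snd x) q'" using \<open>(x, (t, \<phi>)) \<in> causes\<close> by (auto simp: causes_def)
      then show ?thesis using Out[OF rangeI[of \<phi> i]] by simp
    qed
    then show ?case by (auto intro: accI)
  qed simp
  \<comment> \<open>Any out-arc, here \<open>undefined\<close>, turns an event into a condition to
    which the induction applies.\<close>
  from this[of "Out (fst x) (snd x) undefined" for x]
  show "x \<in> Wellfounded.acc causes" for x by simp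
qed

text \<open>Each in-arc names at most one direct cause, so a well-founded induction with finite
  branching applies.\<close>

lemma finite_causes: "finite {x. (x, y) \<in> causes\<^sup>*}"
proof (induction y rule: wf_induct_rule[OF wf_causes])
  case (1 y)
  have "{x. (x, y) \<in> causes} \<subseteq> (\<lambda>i. case snd y i of Init b \<Rightarrow> undefined | Out t \<phi> q \<Rightarrow> (t, \<phi>)) ` pre (fst y)"
    by (force simp: causes_def image_iff)
  then have "finite {x. (x, y) \<in> causes}"
    using finite_pre by (meson finite_imageI finite_subset)
  moreover have "{x. (x, y) \<in> causes\<^sup>*} = insert y (\<Union>z\<in>{x. (x, y) \<in> causes}. {x. (x, z) \<in> causes\<^sup>*})"
    by (auto elim: rtranclE intro: rtrancl_into_rtrancl)
  ultimately show ?case using 1 by simp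
qed

lemma events_lower: "\<lbrakk>(x, y) \<in> causes\<^sup>*; y \<in> events\<rbrakk> \<Longrightarrow> x \<in> events"
  unfolding events_def conflict_free_def by (blast intro: rtrancl_trans)

lemma events_enabled: "x \<in> events \<Longrightarrow> enabled x"
  unfolding events_def by blast

lemma eventsD:
  assumes "x \<in> events"
  shows "fst x \<in> nodes P" "snd x \<in> extensional (pre (fst x))"
    "i \<in> pre (fst x) \<Longrightarrow> place (snd x i) = in_edge P i"
    "\<lbrakk>i \<in> pre (fst x); snd x i = Init b\<rbrakk> \<Longrightarrow> b \<in> B"
    "\<lbrakk>i \<in> pre (fst x); snd x i = Out t \<phi> q\<rbrakk> \<Longrightarrow> q \<in> outs P \<and> out_node P q = t"
    "\<lbrakk>i \<in> pre (fst x); snd x i = Out t \<phi> q\<rbrakk> \<Longrightarrow> (t, \<phi>) \<in> events"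
proof -
  show "fst x \<in> nodes P" "snd x \<in> extensional (pre (fst x))"
    using events_enabled[OF assms] by (simp_all add: enabled_def)
  have "i \<in> pre (fst x) \<Longrightarrow> place (snd x i) = in_edge P i \<and>
      (case snd x i of Init b \<Rightarrow> b \<in> B | Out t \<phi> q \<Rightarrow> q \<in> outs P \<and> out_node P q = t)"
    using events_enabled[OF assms] by (simp add: enabled_def)
  then show "i \<in> pre (fst x) \<Longrightarrow> place (snd x i) = in_edge P i"
    "\<lbrakk>i \<in> pre (fst x); snd x i = Init b\<rbrakk> \<Longrightarrow> b \<in> B"
    "\<lbrakk>i \<in> pre (fst x); snd x i = Out t \<phi> q\<rbrakk> \<Longrightarrow> q \<in> outs P \<and> out_node P q = t"
    by simp_all
  assume "i \<in> pre (fst x)" "snd x i = Out t \<phi> q"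
  then have "((t, \<phi>), x) \<in> causes" by (auto simp: causes_def)
  then show "(t, \<phi>) \<in> events" using events_lower assms by blast
qed

section \<open>The net of events as an unfolding of \<open>P\<close>\<close>

lemma unf_simps [simp]:
  "nodes unf = events" "(x, i) \<in> ins unf \<longleftrightarrow> x \<in> events \<and> i \<in> pre (fst x)"
  "(x, q) \<in> outs unf \<longleftrightarrow> x \<in> events \<and> q \<in> outs P \<and> out_node P q = fst x"
  "in_edge unf (x, i) = snd x i" "in_node unf = fst" "out_node unf = fst"
  "out_edge unf (x, q) = Out (fst x) (snd x) q"
  "Init b \<in> edges unf \<longleftrightarrow> b \<in> B"
  "Out t \<phi> q \<in> edges unf \<longleftrightarrow> (t, \<phi>) \<in> events \<and> q \<in> outs P \<and> out_node P q = t"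
  by (auto simp: unf_def)

lemma in_edge_unf: "\<lbrakk>x \<in> events; i \<in> pre (fst x)\<rbrakk> \<Longrightarrow> snd x i \<in> edges unf"
  by (cases "snd x i") (auto dest: eventsD(4-6))

lemma net_unf: "net unf"
proof -
  have "finite {i \<in> ins unf. fst i = x}" "finite {q \<in> outs unf. fst q = x}" if "x \<in> events" for x
  proof -
    show "finite {i \<in> ins unf. fst i = x}"
      by (rule finite_subset[OF _ finite_cartesian_product[of "{x}" "pre (fst x)"]]) (auto simp: finite_pre)
    show "finite {q \<in> outs unf. fst q = x}"
      using finite_net
      by (intro finite_subset[OF _ finite_cartesian_product[of "{x}" "outs P"]]) (auto simp: finite_net_def)
  qed
  then show ?thesis using in_edge_unf by (auto simp: net_def)
qed

lemma prec_unf: "(x, y) \<in> prec unf \<Longrightarrow> (x, y) \<in> causes"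
  by (fastforce simp: prec_iff[OF net_unf] causes_def)

lemma prec_unf_rtrancl: "(x, y) \<in> (prec unf)\<^sup>* \<Longrightarrow> (x, y) \<in> causes\<^sup>*"
  by (erule rtrancl_mono[THEN subsetD, rotated]) (auto dest: prec_unf)

text \<open>Precedence is contained in \<open>causes\<close>, which supplies well-foundedness.
  Conflict-freeness of \<open>y\<close> gives the graph property of its lower set and, with all
  events equal, the relation property of in-arcs; out-arcs can be recovered from the conditions they
  produce.\<close>

lemma unf_occurrence: "occurrence_hypergraph unf"
  unfolding occurrence_hypergraph_iff
proof (intro conjI ballI)
  have free: "x = x' \<and> i = i'" if "y \<in> events" "(x, y) \<in> causes\<^sup>*" "(x', y) \<in> causes\<^sup>*"
    "i \<in> pre (fst x)" "i' \<in> pre (fst x')" "snd x i = snd x' i'" for x x' y i i'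
  proof -
    have "conflict_free y" using that(1) by (simp add: events_def)
    then show ?thesis using that(2-) unfolding conflict_free_def by blast
  qed
  show "hypergraph unf"
    unfolding hypergraph_def inj_on_def
  proof (intro conjI ballI impI net_unf)
    fix a a' assume "a \<in> ins unf" "a' \<in> ins unf"
      "(in_edge unf a, in_node unf a) = (in_edge unf a', in_node unf a')"
    then show "a = a'" using free[of "fst a" "fst a" "fst a" "snd a" "snd a'"]
      by (cases a; cases a') auto
  qed auto
  show "forward unf" by (auto simp: forward_def inj_on_def prod_eq_iff)
  have "prec unf \<subseteq> causes" using prec_unf by auto
  then have "irrefl ((prec unf)\<^sup>+)"
    using wf_acyclic[OF wf_subset[OF wf_causes]] by (simp add: irrefl_def acyclic_def)
  moreover have "finite {x. (x, y) \<in> (prec unf)\<^sup>*}" for y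
    by (rule finite_subset[OF _ finite_causes]) (auto dest: prec_unf_rtrancl)
  ultimately show "well_founded unf" by (simp add: well_founded_def)
  show "inj_on (in_edge unf) {i \<in> ins unf. (in_node unf i, y) \<in> (prec unf)\<^sup>*}" if "y \<in> nodes unf" for y
  proof (rule inj_onI)
    fix a a' assume "a \<in> {i \<in> ins unf. (in_node unf i, y) \<in> (prec unf)\<^sup>*}"
      "a' \<in> {i \<in> ins unf. (in_node unf i, y) \<in> (prec unf)\<^sup>*}" "in_edge unf a = in_edge unf a'"
    then show "a = a'" using that free[of y "fst a" "fst a'" "snd a" "snd a'"] prec_unf_rtrancl
      by (cases a; cases a') auto
  qed
qed

lemma unf_B_hypergraph: "B_hypergraph B unf unf_init"
proof (rule B_hypergraphI)
  show "hypergraph unf" "forward unf"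
    using unf_occurrence by (auto simp: occurrence_hypergraph_def)
  show "net_map (discrete B) unf unf_init"
    by (auto simp: net_map_def unf_init_def)
  show "inj_on (on_edges unf_init) B" by (auto simp: unf_init_def inj_on_def)
  show "on_edges unf_init b \<notin> out_edge unf ` outs unf" if "b \<in> B" for b
    using that by (auto simp: unf_init_def)
  show "a \<in> on_edges unf_init ` B \<or> a \<in> out_edge unf ` outs unf" if "a \<in> edges unf" for a
  proof (cases a)
    case (Out t \<phi> q)
    then have "a = out_edge unf ((t, \<phi>), q)" "((t, \<phi>), q) \<in> outs unf" using that by auto
    then show ?thesis by blast
  qed (use that in \<open>auto simp: unf_init_def\<close>)
qed

lemma unf_fold_map: "net_map unf P unf_fold"
  unfolding net_map_def
proof (intro conjI ballI)
  have "place c \<in> edges P" if "c \<in> edges unf" for c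
    using that net_mapD(1)[OF marking_map] netD(4)[OF netP] by (cases c) (auto simp: place_def)
  then show "on_edges unf_fold \<in> edges unf \<rightarrow>\<^sub>E edges P"
    by (auto simp: unf_fold_def)
qed (use in_edge_unf eventsD(1,3) in \<open>auto simp: unf_fold_def pre_def, auto simp: place_def\<close>)

lemma unf_fold_etale: "etale unf P unf_fold"
proof (rule etaleI[OF net_unf unf_fold_map])
  show "\<exists>i'\<in>ins unf. in_node unf i' = x \<and> on_ins unf_fold i' = i"
    if "x \<in> nodes unf" "i \<in> ins P" "in_node P i = on_nodes unf_fold x" for x i
    using that by (intro bexI[of _ "(x, i)"]) (auto simp: unf_fold_def pre_def)
  show "\<exists>q'\<in>outs unf. out_node unf q' = x \<and> on_outs unf_fold q' = q"
    if "x \<in> nodes unf" "q \<in> outs P" "out_node P q = on_nodes unf_fold x" for x q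
    using that by (intro bexI[of _ "(x, q)"]) (auto simp: unf_fold_def)
qed (auto simp: unf_fold_def)

lemma unf_unfolding: "is_unfolding P B m unf unf_init unf_fold"
proof -
  have "net_comp (discrete B) unf_fold unf_init = m"
    by (rule net_map_eqI[OF net_map_comp[OF net_discrete B_hypergraphD(2)[OF unf_B_hypergraph] unf_fold_map]
          marking_map]) (auto simp: unf_fold_def unf_init_def place_def)
  then show ?thesis
    using unf_occurrence unf_B_hypergraph unf_fold_etale by (simp add: is_unfolding_def)
qed

text \<open>The conditions are stratified by nesting depth; each level is finite since
  \<open>P\<close> and \<open>B\<close> are, and every event draws its inputs from one
  level.\<close>

lemma countable_events: "countable events"
proof -
  \<comment> \<open>\<open>L n\<close> holds all conditions of depth at most \<open>n\<close>. It
    overshoots, as \<open>Out t\<close> is paired with every out-arc of \<open>P\<close>, but only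
    finiteness matters.\<close>
  define L :: "nat \<Rightarrow> ('b, 'i, 't, 'o) cond set" where
    "L = rec_nat (Init ` B) (\<lambda>_ C. Init ` B \<union>
      (\<Union>t\<in>nodes P. \<Union>\<phi>\<in>pre t \<rightarrow>\<^sub>E C. Out t \<phi> ` outs P))"
  have L0: "L 0 = Init ` B"
    and LS: "L (Suc n) = Init ` B \<union> (\<Union>t\<in>nodes P. \<Union>\<phi>\<in>pre t \<rightarrow>\<^sub>E L n. Out t \<phi> ` outs P)" for n
    by (simp_all add: L_def)
  have fin: "finite (L n)" for n
    using finite_net finite_B finite_pre
    by (induction n) (auto simp: L0 LS finite_net_def intro!: finite_PiE)
  have "L n \<subseteq> L (Suc n)" for n
  proof (induction n)
    case (Suc n)
    show ?case
      unfolding LS[of "Suc n"] by (subst LS) (intro Un_mono UN_mono PiE_mono Suc subset_refl)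
  qed (simp add: L0 LS)
  then have mono: "L n \<subseteq> L n'" if "n \<le> n'" for n n' using that by (rule lift_Suc_mono_le)
  have *: "\<exists>n. snd x \<in> pre (fst x) \<rightarrow>\<^sub>E L n" if "x \<in> events" for x
    using that
  proof (induction x rule: wf_induct_rule[OF wf_causes])
    case (1 x)
    have "\<exists>n. snd x i \<in> L n" if i: "i \<in> pre (fst x)" for i
    proof (cases "snd x i")
      case (Init b)
      then have "snd x i \<in> L 0" using eventsD(4)[OF 1(2) i] by (simp add: L0)
      then show ?thesis ..
    next
      case (Out t \<phi> q)
      then have c: "((t, \<phi>), x) \<in> causes" using i by (auto simp: causes_def)
      have ev: "(t, \<phi>) \<in> events" by (rule eventsD(6)[OF 1(2) i Out])
      then obtain n where "\<phi> \<in> pre t \<rightarrow>\<^sub>E L n" using 1(1)[OF c] by auto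
      moreover have "q \<in> outs P" using eventsD(5)[OF 1(2) i Out] by simp
      moreover have "t \<in> nodes P" using eventsD(1)[OF ev] by simp
      ultimately have "snd x i \<in> L (Suc n)"
        unfolding LS Out by (intro UnI2 UN_I[of t] UN_I[of \<phi>] imageI)
      then show ?thesis ..
    qed
    then obtain n where n: "\<And>i. i \<in> pre (fst x) \<Longrightarrow> snd x i \<in> L (n i)" by metis
    \<comment> \<open>One level must serve all in-arcs at once; there are finitely many, and the
      levels increase.\<close>
    have "snd x i \<in> L (Max (n ` pre (fst x)))" if i: "i \<in> pre (fst x)" for i
      using n[OF i] mono[of "n i" "Max (n ` pre (fst x))"] i finite_pre by auto
    then have "snd x \<in> pre (fst x) \<rightarrow>\<^sub>E L (Max (n ` pre (fst x)))"
      using eventsD(2)[OF 1(2)] by (simp add: PiE_iff)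
    then show ?case ..
  qed
  have "events \<subseteq> (\<Union>n. SIGMA t : nodes P. pre t \<rightarrow>\<^sub>E L n)"
  proof (intro subsetI)
    fix x assume x: "x \<in> events"
    then obtain n where "snd x \<in> pre (fst x) \<rightarrow>\<^sub>E L n" using * by blast
    then have "x \<in> (SIGMA t : nodes P. pre t \<rightarrow>\<^sub>E L n)" using eventsD(1)[OF x] by (cases x) auto
    then show "x \<in> (\<Union>n. SIGMA t : nodes P. pre t \<rightarrow>\<^sub>E L n)" by blast
  qed
  moreover have "finite (SIGMA t : nodes P. pre t \<rightarrow>\<^sub>E L n)" for n
    using finite_net finite_pre fin by (auto simp: finite_net_def intro!: finite_PiE)
  ultimately show ?thesis
    by (rule countable_subset[OF _ countable_UN[OF countableI_type countable_finite]])
qed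

section \<open>Maps from an unfolding into the net of events\<close>

text \<open>Commuting with the projection to \<open>P\<close> fixes everything about the map except
  the assignments of the events. An assignment is the image of the consumed edges, which depends
  only on the events of earlier nodes, so induction along \<open>prec H\<close> applies.\<close>

lemma unf_map_unique:
  assumes H: "is_unfolding P B m H k p"
    and f: "B_map B H k unf unf_init f" "net_comp H unf_fold f = p"
    and g: "B_map B H k unf unf_init g" "net_comp H unf_fold g = p"
  shows "f = g"
proof -
  note netH = is_unfoldingD(2)[OF H] and f' = B_mapD(1)[OF f(1)] and g' = B_mapD(1)[OF g(1)]
  have shape: "fst (on_nodes h x) = on_nodes p x \<and> on_nodes h x \<in> events"
    "i \<in> ins H \<Longrightarrow> on_ins h i = (on_nodes h (in_node H i), on_ins p i)"
    "q \<in> outs H \<Longrightarrow> on_outs h q = (on_nodes h (out_node H q), on_outs p q)"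
    if h: "B_map B H k unf unf_init h" "net_comp H unf_fold h = p" and x: "x \<in> nodes H" for h x i q
  proof -
    note h' = B_mapD(1)[OF h(1)]
    show "fst (on_nodes h x) = on_nodes p x \<and> on_nodes h x \<in> events"
      using x on_net_comp(3)[OF x, of unf_fold h] etaleD(3)[OF h' x] h(2) by (auto simp: unf_fold_def)
    show "on_ins h i = (on_nodes h (in_node H i), on_ins p i)" if i: "i \<in> ins H"
      using on_net_comp(2)[OF i, of unf_fold h] etaleD(2,6)[OF h' i] h(2)
      by (auto simp: unf_fold_def prod_eq_iff)
    show "on_outs h q = (on_nodes h (out_node H q), on_outs p q)" if q: "q \<in> outs H"
      using on_net_comp(4)[OF q, of unf_fold h] etaleD(4,7)[OF h' q] h(2)
      by (auto simp: unf_fold_def prod_eq_iff)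
  qed
  \<comment> \<open>Agreement is required only at the producer of \<open>a\<close>, so the claim is
    usable inside the induction on nodes.\<close>
  have edges: "on_edges f a = on_edges g a"
    if a: "a \<in> edges H" and eq: "\<And>q. \<lbrakk>q \<in> outs H; out_edge H q = a\<rbrakk> \<Longrightarrow>
      on_nodes f (out_node H q) = on_nodes g (out_node H q)" for a
    using is_unfoldingD(1)[OF H] a
  proof (cases rule: B_hypergraph_edge_cases)
    case (boundary b)
    then show ?thesis using B_mapD(3)[OF f(1)] B_mapD(3)[OF g(1)] by simp
  next
    case (out q)
    note x = netD(3)[OF netH out(1)]
    have "on_outs f q = on_outs g q"
      using shape(3)[OF f x out(1)] shape(3)[OF g x out(1)] eq out by simp
    then show ?thesis using out etaleD(8)[OF f' out(1)] etaleD(8)[OF g' out(1)] by simp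
  qed
  have nodes: "on_nodes f x = on_nodes g x" if "x \<in> nodes H" for x
    using that
  proof (induction x rule: wf_induct_rule[OF wf_prec[OF is_unfoldingD(6)[OF H]]])
    case (1 x)
    have "snd (on_nodes f x) i = snd (on_nodes g x) i" if i: "i \<in> pre (on_nodes p x)" for i
    proof -
      have "i \<in> ins P" "in_node P i = on_nodes p x" using i by (auto simp: pre_def)
      then obtain i' where i': "i' \<in> ins H" "in_node H i' = x" "on_ins p i' = i"
        by (rule etale_in_lift[OF is_unfoldingD(4)[OF H] 1(2)])
      have "on_edges f (in_edge H i') = on_edges g (in_edge H i')"
      proof (rule edges[OF netD(1)[OF netH i'(1)]])
        fix q assume "q \<in> outs H" "out_edge H q = in_edge H i'"
        moreover then have "(out_node H q, x) \<in> prec H"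
          unfolding prec_iff[OF netH] using i' by metis
        ultimately show "on_nodes f (out_node H q) = on_nodes g (out_node H q)"
          using 1(1) netD(3)[OF netH] by blast
      qed
      then show ?thesis
        using etaleD(5)[OF f' i'(1)] etaleD(5)[OF g' i'(1)] shape(2)[OF f 1(2) i'(1)]
          shape(2)[OF g 1(2) i'(1)] i' by simp
    qed
    moreover have "snd (on_nodes f x) \<in> extensional (pre (on_nodes p x))"
      "snd (on_nodes g x) \<in> extensional (pre (on_nodes p x))"
      using shape(1)[OF f 1(2)] shape(1)[OF g 1(2)] eventsD(2) by metis+
    ultimately have "snd (on_nodes f x) = snd (on_nodes g x)" by (auto intro: extensionalityI)
    then show ?case using shape(1)[OF f 1(2)] shape(1)[OF g 1(2)] by (simp add: prod_eq_iff)
  qed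
  show ?thesis
  proof (rule net_map_eqI[OF etale_net_map[OF f'] etale_net_map[OF g']])
    show "on_edges f a = on_edges g a" if "a \<in> edges H" for a
      using edges[OF that] nodes netD(3)[OF netH] by blast
    show "on_ins f i = on_ins g i" if i: "i \<in> ins H" for i
      using shape(2)[OF f _ i] shape(2)[OF g _ i] nodes netD(2)[OF netH i] by metis
    show "on_outs f q = on_outs g q" if q: "q \<in> outs H" for q
      using shape(3)[OF f _ q] shape(3)[OF g _ q] nodes netD(3)[OF netH q] by metis
  qed (rule nodes)
qed

text \<open>The event at \<open>x\<close> has to assign to \<open>i\<close> the condition of the
  edge consumed by the lift of \<open>i\<close>, and that condition mentions the event of the
  producer: a recursion along \<open>prec H\<close>. The main work is conflict-freeness, for which
  equal conditions must be traced back to equal in-arcs of \<open>H\<close>.\<close>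

lemma unf_map_exists:
  fixes H :: "('a2, 'i2, 'n2, 'o2) net"
  assumes H: "is_unfolding P B m H k p"
  shows "\<exists>f. B_map B H k unf unf_init f \<and> net_comp H unf_fold f = p"
proof -
  note BH = is_unfoldingD(1)[OF H] and netH = is_unfoldingD(2)[OF H] and nk = is_unfoldingD(3)[OF H]
    and p = is_unfoldingD(4)[OF H]
  note wf = wf_prec[OF is_unfoldingD(6)[OF H]]
  \<comment> \<open>The in-arc of \<open>H\<close> at \<open>x\<close> lying over \<open>i\<close>,
    unique because \<open>p\<close> is etale.\<close>
  define arc where "arc x i = (SOME i'. i' \<in> ins H \<and> in_node H i' = x \<and> on_ins p i' = i)" for x i
  have arc: "arc (in_node H i) (on_ins p i) = i" if "i \<in> ins H" for i
    unfolding arc_def by (rule some_equality) (use that etale_in_inj[OF p] in auto)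
  \<comment> \<open>The condition of an edge, given the events \<open>F\<close> of the nodes.
    \<open>F\<close> is a parameter because its recursion passes through \<open>C\<close>.\<close>
  define C :: "('n2 \<Rightarrow> ('b, 'i, 't, 'o) event) \<Rightarrow> 'a2 \<Rightarrow> ('b, 'i, 't, 'o) cond" where
    "C F a = (if a \<in> out_edge H ` outs H then
      (let q = inv_into (outs H) (out_edge H) a; x = F (out_node H q) in Out (fst x) (snd x) (on_outs p q))
      else Init (inv_into B (on_edges k) a))" for F a
  have C_init: "C F (on_edges k b) = Init b" if "b \<in> B" for F b
    using that B_hypergraphD(4,6)[OF BH] by (simp add: C_def)
  have C_out: "C F (out_edge H q) = Out (fst (F (out_node H q))) (snd (F (out_node H q))) (on_outs p q)"
    if "q \<in> outs H" for F q
    using that B_hypergraphD(3)[OF BH] by (simp add: C_def Let_def)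
  define F where "F = wfrec (prec H) (\<lambda>F x. (on_nodes p x, \<lambda>i\<in>pre (on_nodes p x). C F (in_edge H (arc x i))))"
  have lift: "\<exists>i'\<in>ins H. in_node H i' = x \<and> on_ins p i' = i"
    if "x \<in> nodes H" "i \<in> pre (on_nodes p x)" for x i
    using etale_in_lift[OF p that(1), of i] that(2) by (auto simp: pre_def)
  have F: "F x = (on_nodes p x, \<lambda>i\<in>pre (on_nodes p x). C F (in_edge H (arc x i)))" if x: "x \<in> nodes H" for x
  proof -
    \<comment> \<open>Only producers of edges consumed at \<open>x\<close> are looked up, and they
      precede \<open>x\<close>, so cutting \<open>F\<close> off changes nothing.\<close>
    have "C (cut F (prec H) x) (in_edge H (arc x i)) = C F (in_edge H (arc x i))"
      if i: "i \<in> pre (on_nodes p x)" for i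
    proof -
      obtain i' where i': "i' \<in> ins H" "in_node H i' = x" "on_ins p i' = i"
        using lift[OF x i] by blast
      then have "arc x i = i'" using arc by blast
      from BH netD(1)[OF netH i'(1)] show ?thesis
      proof (cases rule: B_hypergraph_edge_cases)
        case (boundary b)
        then show ?thesis using \<open>arc x i = i'\<close> by (simp add: C_init)
      next
        case (out q)
        then have "(out_node H q, x) \<in> prec H" unfolding prec_iff[OF netH] using i' by metis
        then show ?thesis using \<open>arc x i = i'\<close> out by (simp add: C_out cut_apply)
      qed
    qed
    then show ?thesis
      unfolding F_def by (subst wfrec[OF wf]) (auto simp: restrict_def fun_eq_iff)
  qed
  have F_fst: "fst (F x) = on_nodes p x" if "x \<in> nodes H" for x using F[OF that] by simp
  have F_snd: "snd (F (in_node H i)) (on_ins p i) = C F (in_edge H i)" if "i \<in> ins H" for i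
    using F[OF netD(2)[OF netH that]] arc[OF that] etaleD(2,6)[OF p that] that by (simp add: pre_def)
  have F_arc: "\<exists>i'\<in>ins H. in_node H i' = x \<and> on_ins p i' = i \<and> snd (F x) i = C F (in_edge H i')"
    if "x \<in> nodes H" "i \<in> pre (fst (F x))" for x i
    using lift[of x i] F_fst[OF that(1)] F_snd that by metis
  have place_C: "place (C F a) = on_edges p a" if "a \<in> edges H" for a
    using BH that
  proof (cases rule: B_hypergraph_edge_cases)
    case (boundary b)
    then have "on_edges p a = on_edges m b"
      using is_unfoldingD(5)[OF H] on_net_comp(1)[of b "discrete B" p k] by simp
    then show ?thesis using boundary by (simp add: C_init place_def)
  next
    case (out q)
    then show ?thesis using etaleD(8)[OF p] by (simp add: C_out place_def)
  qed
  have enabled: "enabled (F x)" if x: "x \<in> nodes H" for x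
    unfolding enabled_def
  proof (intro conjI ballI)
    show "fst (F x) \<in> nodes P" using F_fst[OF x] etaleD(3)[OF p x] by simp
    show "snd (F x) \<in> extensional (pre (fst (F x)))" using F[OF x] by simp
    fix i assume "i \<in> pre (fst (F x))"
    then obtain i' where i': "i' \<in> ins H" "in_node H i' = x" "on_ins p i' = i" "snd (F x) i = C F (in_edge H i')"
      using F_arc[OF x] by blast
    note a = netD(1)[OF netH i'(1)]
    show "place (snd (F x) i) = in_edge P i"
      using place_C[OF a] etaleD(5)[OF p i'(1)] i' by simp
    from BH a show "case snd (F x) i of Init b \<Rightarrow> b \<in> B | Out t \<phi> q \<Rightarrow> q \<in> outs P \<and> out_node P q = t"
    proof (cases rule: B_hypergraph_edge_cases)
      case (out q)
      then show ?thesis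
        using etaleD(4,7)[OF p out(1)] F_fst[OF netD(3)[OF netH out(1)]] i' by (simp add: C_out)
    qed (use i' in \<open>simp add: C_init\<close>)
  qed
  \<comment> \<open>Causes lift back to \<open>H\<close>; iterated in \<open>lower_F\<close>, this
    exhibits the history of \<open>F x\<close> as coming from the lower set of \<open>x\<close>,
    where the occurrence conditions are available.\<close>
  have causes_F: "\<exists>z. (z, x) \<in> prec H \<and> y = F z" if x: "x \<in> nodes H" and y: "(y, F x) \<in> causes" for x y
  proof -
    obtain i r where i: "i \<in> pre (fst (F x))" "snd (F x) i = Out (fst y) (snd y) r"
      using y by (auto simp: causes_def)
    obtain i' where i': "i' \<in> ins H" "in_node H i' = x" "snd (F x) i = C F (in_edge H i')"
      using F_arc[OF x i(1)] by blast
    from BH netD(1)[OF netH i'(1)] show ?thesis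
    proof (cases rule: B_hypergraph_edge_cases)
      case (boundary b)
      then show ?thesis using i(2) i'(3) by (simp add: C_init)
    next
      case (out q)
      then have "(out_node H q, x) \<in> prec H" unfolding prec_iff[OF netH] using i' by metis
      moreover have "y = F (out_node H q)" using i(2) i'(3) out by (simp add: C_out prod_eq_iff)
      ultimately show ?thesis by blast
    qed
  qed
  have lower_F: "\<exists>z. (z, x) \<in> (prec H)\<^sup>* \<and> y = F z" if x: "x \<in> nodes H" and y: "(y, F x) \<in> causes\<^sup>*" for x y
    using y
  proof (induction rule: converse_rtrancl_induct)
    case (step y w)
    then obtain z where z: "(z, x) \<in> (prec H)\<^sup>*" "w = F z" by blast
    then show ?case
      using causes_F[OF prec_rtrancl_nodes[OF netH x z(1)]] step(1)
      by (blast intro: converse_rtrancl_into_rtrancl)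
  qed blast
  \<comment> \<open>Injectivity of \<open>F\<close> is asked only of predecessors of the two nodes.
    The induction hypothesis of \<open>F_inj\<close> provides just that, and afterwards
    \<open>F_inj\<close> itself does.\<close>
  have C_inj: "i = i'"
    if y: "y \<in> nodes H" and i: "i \<in> ins H" "i' \<in> ins H" "(in_node H i, y) \<in> (prec H)\<^sup>*" "(in_node H i', y) \<in> (prec H)\<^sup>*"
      and eq: "C F (in_edge H i) = C F (in_edge H i')"
      and inj: "\<And>z z'. \<lbrakk>(z, in_node H i) \<in> prec H; (z', in_node H i') \<in> prec H; F z = F z'\<rbrakk> \<Longrightarrow> z = z'" for y i i'
  proof -
    have "in_edge H i = in_edge H i'"
      using BH netD(1)[OF netH i(1)]
    proof (cases rule: B_hypergraph_edge_cases)
      case (boundary b)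
      from BH netD(1)[OF netH i(2)] show ?thesis
        by (cases rule: B_hypergraph_edge_cases) (use boundary eq in \<open>auto simp: C_init C_out\<close>)
    next
      case out1: (out q)
      from BH netD(1)[OF netH i(2)] show ?thesis
      proof (cases rule: B_hypergraph_edge_cases)
        case (boundary b)
        then show ?thesis using out1 eq by (simp add: C_init C_out)
      next
        case out2: (out q')
        have F: "F (out_node H q) = F (out_node H q')" and q: "on_outs p q = on_outs p q'"
          using eq out1 out2 by (simp_all add: C_out prod_eq_iff)
        have "(out_node H q, in_node H i) \<in> prec H" "(out_node H q', in_node H i') \<in> prec H"
          unfolding prec_iff[OF netH] using i out1 out2 by metis+
        then have "out_node H q = out_node H q'" using inj F by blast
        then have "q = q'" using etale_out_inj[OF p out1(1) out2(1)] q by blast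
        then show ?thesis using out1 out2 by simp
      qed
    qed
    moreover have "inj_on (in_edge H) {i \<in> ins H. (in_node H i, y) \<in> (prec H)\<^sup>*}"
      using is_unfoldingD(6)[OF H] y by (simp add: occurrence_hypergraph_iff)
    ultimately show ?thesis using i by (auto dest: inj_onD)
  qed
  have F_inj: "x = x'" if y: "y \<in> nodes H" and "(x, y) \<in> (prec H)\<^sup>*" "(x', y) \<in> (prec H)\<^sup>*" "F x = F x'" for x x' y
    using that(2-)
  proof (induction x arbitrary: x' rule: wf_induct_rule[OF wf])
    case (1 x)
    have x: "x \<in> nodes H" "x' \<in> nodes H" using prec_rtrancl_nodes[OF netH y] 1(2,3) by blast+
    \<comment> \<open>Groundedness enters here. Equal events assign the same condition to
      \<open>i\<close>, so by \<open>C_inj\<close> both nodes consume through one in-arc of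
      \<open>H\<close>, and that arc has only one node.\<close>
    obtain i where i: "i \<in> pre (fst (F x))"
      using pre_nonempty etaleD(3)[OF p x(1)] F_fst[OF x(1)] by metis
    obtain i1 where i1: "i1 \<in> ins H" "in_node H i1 = x" "snd (F x) i = C F (in_edge H i1)"
      using F_arc[OF x(1) i] by blast
    obtain i2 where i2: "i2 \<in> ins H" "in_node H i2 = x'" "snd (F x) i = C F (in_edge H i2)"
      using F_arc[OF x(2)] i 1(4) by metis
    have "i1 = i2"
    proof (rule C_inj[OF y i1(1) i2(1)])
      show "z = z'" if "(z, in_node H i1) \<in> prec H" "(z', in_node H i2) \<in> prec H" "F z = F z'" for z z'
        using 1(1)[of z z'] that i1(2) i2(2) 1(2,3) by (meson converse_rtrancl_into_rtrancl)
    qed (use i1 i2 1 in auto)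
    then show ?case using i1(2) i2(2) by simp
  qed
  have events: "F y \<in> events" if y: "y \<in> nodes H" for y
    unfolding events_def conflict_free_def
  proof (intro CollectI conjI allI impI)
    show "enabled x" if "(x, F y) \<in> causes\<^sup>*" for x
      using lower_F[OF y that] enabled prec_rtrancl_nodes[OF netH y] by blast
    fix x x' i i' assume xs: "(x, F y) \<in> causes\<^sup>*" "(x', F y) \<in> causes\<^sup>*"
      and i: "i \<in> pre (fst x)" "i' \<in> pre (fst x')" and eq: "snd x i = snd x' i'"
    obtain z where z: "(z, y) \<in> (prec H)\<^sup>*" "x = F z" using lower_F[OF y xs(1)] by blast
    obtain z' where z': "(z', y) \<in> (prec H)\<^sup>*" "x' = F z'" using lower_F[OF y xs(2)] by blast
    note zn = prec_rtrancl_nodes[OF netH y z(1)] and zn' = prec_rtrancl_nodes[OF netH y z'(1)]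
    obtain i1 where i1: "i1 \<in> ins H" "in_node H i1 = z" "on_ins p i1 = i" "snd x i = C F (in_edge H i1)"
      using F_arc[OF zn] i(1) z(2) by metis
    obtain i2 where i2: "i2 \<in> ins H" "in_node H i2 = z'" "on_ins p i2 = i'" "snd x' i' = C F (in_edge H i2)"
      using F_arc[OF zn'] i(2) z'(2) by metis
    have "i1 = i2"
    proof (rule C_inj[OF y i1(1) i2(1)])
      show "w = w'" if "(w, in_node H i1) \<in> prec H" "(w', in_node H i2) \<in> prec H" "F w = F w'" for w w'
        using F_inj[OF y _ _ that(3)] that(1,2) i1(2) i2(2) z(1) z'(1)
        by (meson converse_rtrancl_into_rtrancl)
    qed (use i1 i2 z z' eq in auto)
    then show "x = x'" "i = i'" using i1 i2 z z' by auto
  qed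
  define f where "f = \<lparr> on_edges = restrict (C F) (edges H), on_ins = (\<lambda>i\<in>ins H. (F (in_node H i), on_ins p i)),
    on_nodes = restrict F (nodes H), on_outs = (\<lambda>q\<in>outs H. (F (out_node H q), on_outs p q))\<rparr>"
  have fi: "(F (in_node H i), on_ins p i) \<in> ins unf" if "i \<in> ins H" for i
    using netD(2)[OF netH that] etaleD(2,6)[OF p that] that by (simp add: F_fst events pre_def)
  have fo: "(F (out_node H q), on_outs p q) \<in> outs unf" if "q \<in> outs H" for q
    using netD(3)[OF netH that] etaleD(4,7)[OF p that] that by (simp add: F_fst events)
  have fe: "C F a \<in> edges unf" if "a \<in> edges H" for a
    using BH that
  proof (cases rule: B_hypergraph_edge_cases)
    case (out q)
    then show ?thesis using fo[of q] by (simp add: C_out)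
  qed (simp add: C_init)
  have map: "net_map H unf f"
    using fi fo fe events netD(1-4)[OF netH]
    by (auto simp: net_map_def f_def F_snd C_out simp del: unf_simps(2,3))
  have "etale H unf f"
  proof (rule etaleI[OF netH map])
    show "i = i'" if "i \<in> ins H" "i' \<in> ins H" "in_node H i = in_node H i'" "on_ins f i = on_ins f i'" for i i'
      using etale_in_inj[OF p that(1-3)] that by (simp add: f_def)
    show "q = q'" if "q \<in> outs H" "q' \<in> outs H" "out_node H q = out_node H q'" "on_outs f q = on_outs f q'" for q q'
      using etale_out_inj[OF p that(1-3)] that by (simp add: f_def)
    show "\<exists>i'\<in>ins H. in_node H i' = x \<and> on_ins f i' = i"
      if x: "x \<in> nodes H" and i: "i \<in> ins unf" "in_node unf i = on_nodes f x" for x i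
      using lift[OF x, of "snd i"] F_fst[OF x] i x by (cases i) (auto simp: f_def)
    show "\<exists>q'\<in>outs H. out_node H q' = x \<and> on_outs f q' = q"
      if x: "x \<in> nodes H" and q: "q \<in> outs unf" "out_node unf q = on_nodes f x" for x q
    proof -
      have "snd q \<in> outs P \<and> out_node P (snd q) = on_nodes p x"
        using q x F_fst[OF x] by (cases q) (auto simp: f_def)
      then obtain q' where q': "q' \<in> outs H" "out_node H q' = x" "on_outs p q' = snd q"
        by (elim conjE) (rule etale_out_lift[OF p x])
      have "on_outs f q' = q" using q' q x by (cases q) (simp add: f_def)
      with q' show ?thesis by blast
    qed
  qed
  moreover have "net_comp (discrete B) f k = unf_init"
    by (rule net_map_eqI[OF net_map_comp[OF net_discrete nk map] B_hypergraphD(2)[OF unf_B_hypergraph]])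
      (use B_hypergraphD(5)[OF BH] in \<open>auto simp: f_def unf_init_def C_init\<close>)
  moreover have "net_comp H unf_fold f = p"
    by (rule net_map_eqI[OF net_map_comp[OF netH map unf_fold_map] etale_net_map[OF p]])
      (use fi fo fe events F_fst place_C in \<open>auto simp: f_def unf_fold_def\<close>)
  ultimately show ?thesis by (auto simp: B_map_def)
qed

text \<open>Since \<open>events\<close> is countable, \<open>lower_set_copy\<close> applies to the
  set of all nodes. Maps into \<open>unf\<close> then factor through the copy by
  \<open>net_inj_factor\<close>, and uniqueness descends because \<open>e\<close> can be
  cancelled.\<close>

lemma universal_unfolding_exists:
  "\<exists>(U :: nnet) j \<epsilon>. universal_unfolding TYPE(('a, 'e, 'n, 'r) net) P B m U j \<epsilon>"
proof -
  obtain U :: nnet and j e where U: "B_hypergraph B U j" "B_map B U j unf unf_init e" "net_inj U e"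
    "on_nodes e ` nodes U = nodes unf"
    by (rule lower_set_copy[OF unf_B_hypergraph countable_finite[OF finite_B] subset_refl])
      (use countable_events prec_nodes(1)[OF net_unf] in auto)
  note netU = B_hypergraphD(1)[OF U(1)] and e = B_mapD(1)[OF U(2)]
  have "\<exists>!f. B_map B H k U j f \<and> net_comp H (net_comp U unf_fold e) f = p"
    if H: "is_unfolding P B m H k p" for H :: "('a, 'e, 'n, 'r) net" and k p
  proof -
    note netH = is_unfoldingD(2)[OF H] and nk = is_unfoldingD(3)[OF H]
    obtain g where g: "B_map B H k unf unf_init g" "net_comp H unf_fold g = p"
      using unf_map_exists[OF H] by blast
    have "on_nodes g ` nodes H \<subseteq> on_nodes e ` nodes U"
      using etaleD(3)[OF B_mapD(1)[OF g(1)]] U(4) by blast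
    then obtain f where f: "B_map B H k U j f" "net_comp H e f = g"
      by (rule net_inj_factor[OF is_unfoldingD(1)[OF H] U(1-3) g(1)])
    show ?thesis
    proof (rule ex1I[of _ f])
      show "B_map B H k U j f \<and> net_comp H (net_comp U unf_fold e) f = p"
        using f g(2) by (simp add: net_comp_assoc[OF etale_net_map[OF B_mapD(1)[OF f(1)]]])
      fix f' assume f': "B_map B H k U j f' \<and> net_comp H (net_comp U unf_fold e) f' = p"
      then have nf': "net_map H U f'" by (simp add: B_map_def etale_net_map)
      have "net_comp H e f' = g"
        using f' B_map_comp[OF netH nk _ U(2)]
        by (intro unf_map_unique[OF H _ _ g]) (auto simp flip: net_comp_assoc[OF nf'])
      then show "f' = f"
        using f by (intro net_inj_monic[OF netU e U(3) nf' etale_net_map[OF B_mapD(1)[OF f(1)]]]) simp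
    qed
  qed
  then have "universal_unfolding TYPE(('a, 'e, 'n, 'r) net) P B m U j (net_comp U unf_fold e)"
    using unfolding_reflect[OF unf_unfolding U(1-3)] by (simp add: universal_unfolding_def)
  then show ?thesis by blast
qed

end

text \<open>Universality among natural-number carriers is the one notion that can be both asserted
  and assumed within a single formula. The free types of the second conjunct extend it to test
  objects and cocone vertices on any carriers, and the last equation says that the colimit legs lie
  over \<open>P\<close>.\<close>

theorem theorem9p6:
  fixes P :: "('s, 'i, 't, 'o) net"
    and B :: "'b set"
    and m :: "('b, unit, unit, unit, 's, 'i, 't, 'o) net_map"
  assumes "finite_net P" and "grounded P" and "finite B" and "marking P B m"
  shows
    "(\<exists>(U :: nnet) j \<epsilon>. universal_unfolding TYPE(nnet) P B m U j \<epsilon>) \<and>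
     (\<forall>(U :: ('a1, 'e1, 'n1, 'r1) net) j \<epsilon>.
        universal_unfolding TYPE(nnet) P B m U j \<epsilon> \<longrightarrow>
          universal_unfolding TYPE(('a, 'e, 'n, 'r) net) P B m U j \<epsilon> \<and>
          (\<exists>c. process_colimit TYPE(('a, 'e, 'n, 'r) net) P B m U j c \<and>
             (\<forall>G k p. is_process P B m G k p \<longrightarrow> net_comp G \<epsilon> (c G k p) = p)))"
proof -
  interpret marked_net P B m using assms by unfold_locales
  show ?thesis
    using universal_unfolding_exists universal_unfolding_colimit[OF assms(3)] by blast
qed

end
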